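(* Let $S$ be a finite set of points in complex projective $n$-space, with each point coloured red or blue or with both colours. Suppose that for any two distinct points $A,B\in S$ sharing a colour there is a third point $C\in S$ of the other colour, collinear with $A$ and $B$. Then all the points in $S$ are coplanar.
   Context: A point may carry one colour or both colours; "red" includes points carrying both colours, and likewise "blue". The hypothesis means: whenever $A\neq B$ in $S$ are both blue, there is a red point $C\in S\setminus\{A,B\}$ on the line $AB$; and whenever $A\neq B$ in $S$ are both red, there is a blue point $C\in S\setminus\{A,B\}$ on the line $AB$. (If $A,B$ share both colours, both requirements apply.) The point $C$ is allowed to carry both colours. Coplanar means contained in some projective plane ($2$-dimensional flat). *)

theory Defs
  imports "HOL-Analysis.Analysis"
begin

text \<open>
  Complex projective \<open>n\<close>-space is the projectivisation of \<open>complex ^ 'd\<close> with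
  \<open>CARD('d) = n + 1\<close>. A \<open>k\<close>-flat is represented by the complex-linear subspace of
  dimension \<open>k + 1\<close> that it comes from, so points are the \<open>0\<close>-flats and incidence is inclusion.
  Note that \<open>vec.subspace\<close> and \<open>vec.dim\<close> are over the field \<open>complex\<close>, unlike
  \<open>subspace\<close> and \<open>dim\<close>, which are over the reals; for the same reason the library's
  \<open>collinear\<close> and \<open>coplanar\<close> (real affine notions) do not apply here.
\<close>

definition proj_flat :: "nat \<Rightarrow> (complex ^ 'd) set \<Rightarrow> bool" where
  "proj_flat k W \<longleftrightarrow> vec.subspace W \<and> vec.dim W = k + 1"

definition proj_points :: "(complex ^ 'd) set set" where
  "proj_points = {P. proj_flat 0 P}"

definition proj_collinear :: "(complex ^ 'd) set set \<Rightarrow> bool" where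
  "proj_collinear X \<longleftrightarrow> (\<exists>L. proj_flat 1 L \<and> (\<forall>P\<in>X. P \<subseteq> L))"

definition proj_coplanar :: "(complex ^ 'd) set set \<Rightarrow> bool" where
  "proj_coplanar X \<longleftrightarrow> (\<exists>W. proj_flat 2 W \<and> (\<forall>P\<in>X. P \<subseteq> W))"

end

theory Submission
  imports Defs
begin

text \<open>
  Suppose that the points are not coplanar, so that their representing vectors span a space of dimension at
  least four. Projecting from points of the configuration preserves the hypothesis
  (\<open>two_coloured_projection\<close>), so the dimension may be taken to be \<open>d = 4\<close>. Let \<open>n\<close> be the
  number of points. For a linear map \<open>T\<close>, consider the coherences of the vectors \<open>T *v v\<close>, that is, the
  squared cosines of the angles between them. Their sum over all ordered pairs of points is estimated in two ways.

  Upper bound. If \<open>T\<close> puts the points in radial isotropic position, that is, if the projections onto the spans of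
  the vectors \<open>T *v v\<close> add up to \<open>n / d\<close> times the identity, then for each point the coherences
  with all points sum to \<open>n / d\<close>. By \<open>approximate_radial_isotropy\<close> such a \<open>T\<close> exists up to an
  arbitrarily small error provided that no subspace of dimension \<open>k\<close> contains more than \<open>n * k / d\<close> points. The colour
  hypothesis implies this (\<open>no_crowded_flat_points\<close>): each fibre of the projection from a
  subspace that contains at least two points contains at least half as many points as the subspace itself.
  So the total is at most about \<open>n\<^sup>2 / 4\<close>.

  Lower bound. The vectors on a line with \<open>t\<close> points lie in a plane, so their coherences sum to at least
  \<open>t\<^sup>2 / 2\<close>, of which \<open>t * (t - 2) / 2\<close> is due to pairs of different points. The colour hypothesis on the line shows
  that \<open>t * (t - 2)\<close> is at least the number of ordered pairs of different points on the line with the same colour, where a pair with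
  a point of both colours counts one half (\<open>colours_le_coherence_on_line\<close>). Every
  pair lies on exactly one line, and in total there are at least \<open>n * (n - 2) / 2\<close> such pairs, whatever the
  colouring. So the total is at least \<open>n + n * (n - 2) / 4 = n\<^sup>2 / 4 + n / 2\<close>, which exceeds the upper bound.
\<close>

section \<open>The Hermitian inner product\<close>

definition hdot :: "complex ^ 'm \<Rightarrow> complex ^ 'm \<Rightarrow> complex" where
  "hdot x y = (\<Sum>i\<in>UNIV. x $ i * cnj (y $ i))"

lemma hdot_add_left: "hdot (x + y) z = hdot x z + hdot y z"
  by (simp add: hdot_def sum.distrib ring_distribs)

lemma hdot_scale_left: "hdot (c *s x) z = c * hdot x z"
  by (simp add: hdot_def sum_distrib_left mult.assoc)

lemma cnj_hdot: "cnj (hdot x y) = hdot y x"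
  by (simp add: hdot_def mult.commute)

lemma hdot_add_right: "hdot z (x + y) = hdot z x + hdot z y"
  by (simp add: hdot_def sum.distrib ring_distribs)

lemma hdot_scale_right: "hdot z (c *s x) = cnj c * hdot z x"
  by (simp add: hdot_def sum_distrib_left mult_ac)

lemma hdot_diff_left: "hdot (x - y) z = hdot x z - hdot y z"
  by (simp add: hdot_def sum_subtractf ring_distribs)

lemma hdot_diff_right: "hdot z (x - y) = hdot z x - hdot z y"
  by (simp add: hdot_def sum_subtractf ring_distribs)

lemmas hdot_bilinear = hdot_add_left hdot_add_right hdot_diff_left hdot_diff_right
  hdot_scale_left hdot_scale_right

lemma hdot_self: "hdot x x = of_real ((norm x)\<^sup>2)"
  by (simp add: hdot_def norm_vec_def L2_set_def sum_nonneg complex_norm_square[symmetric])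

section \<open>Determinants\<close>

text \<open>This stands in for Hadamard's inequality. Only the existence of some constant matters below,
  so the Leibniz formula is enough: each of its terms is at most the product of the norms of the rows.\<close>

lemma norm_det_le_prod_rows:
  fixes M :: "complex ^ 'm ^ 'm"
  shows "norm (det M) \<le> fact CARD('m) * (\<Prod>i\<in>UNIV. norm (M $ i))"
proof -
  have "norm (det M) \<le> (\<Sum>p\<in>{p. p permutes (UNIV :: 'm set)}. \<Prod>i\<in>UNIV. norm (M $ i))"
    unfolding det_def
  proof (rule sum_norm_le)
    fix p
    have "norm (of_int (sign p) * (\<Prod>i\<in>UNIV. M $ i $ p i)) = (\<Prod>i\<in>UNIV. norm (M $ i $ p i))"
      by (simp add: norm_mult prod_norm sign_def)
    also have "\<dots> \<le> (\<Prod>i\<in>UNIV. norm (M $ i))"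
      by (intro prod_mono conjI norm_ge_zero Finite_Cartesian_Product.norm_nth_le)
    finally show "norm (of_int (sign p) * (\<Prod>i\<in>UNIV. M $ i $ p i)) \<le> (\<Prod>i\<in>UNIV. norm (M $ i))" .
  qed
  then show ?thesis
    by (simp add: card_permutations)
qed

lemma det_identity_except_column:
  fixes x :: "'a::field ^ 'm"
  shows "det (\<chi> i j. if j = k then x $ i else mat 1 $ i $ j) = x $ k"
  using cramer_lemma[of k "mat 1" x] by (simp only: matrix_vector_mul_lid det_I mult_1_right)

text \<open>If \<open>u\<close> has a nonzero \<open>k\<close>-th coordinate, then replacing the \<open>k\<close>-th unit vector by \<open>u\<close>
  gives a basis, and in this basis the matrix differs from the identity in a single row. The
  matrix \<open>P\<close> in the proof is the base change.\<close>

lemma det_identity_plus_rank_one: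
  fixes u v :: "'a::field ^ 'm"
  shows "det (mat 1 + (\<chi> i j. u $ i * v $ j)) = 1 + (\<Sum>i\<in>UNIV. v $ i * u $ i)"
proof (cases "u = 0")
  case True
  then have "(\<chi> i j. u $ i * v $ j) = (0 :: 'a ^ 'm ^ 'm)"
    by (simp add: vec_eq_iff)
  with True show ?thesis
    by simp
next
  case False
  then obtain k where k: "u $ k \<noteq> 0"
    by (auto simp: vec_eq_iff)
  define P :: "'a ^ 'm ^ 'm" where "P = (\<chi> i j. if j = k then u $ i else mat 1 $ i $ j)"
  define w :: "'a ^ 'm" where "w = (\<chi> j. if j = k then (\<Sum>i\<in>UNIV. v $ i * u $ i) else v $ j)"
  define R :: "'a ^ 'm ^ 'm" where
    "R = transpose (\<chi> i j. if j = k then (w + axis k 1) $ i else mat 1 $ i $ j)"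
  have "(mat 1 + (\<chi> i j. u $ i * v $ j)) ** P = P ** R"
  proof -
    have L: "((mat 1 + (\<chi> i j. u $ i * v $ j)) ** P) $ i $ j = P $ i $ j + u $ i * w $ j" for i j
    proof -
      have "(\<Sum>l\<in>UNIV. v $ l * P $ l $ j) = w $ j"
        by (auto simp: P_def w_def mat_def if_distrib[of "\<lambda>x. _ * x"] cong: if_cong)
      then have "((\<chi> i j. u $ i * v $ j) ** P) $ i $ j = u $ i * w $ j"
        by (simp add: matrix_matrix_mult_def mult.assoc flip: sum_distrib_left)
      then show ?thesis
        by (simp add: matrix_matrix_mult_def ring_distribs sum.distrib mat_def
            if_distrib[of "\<lambda>x. x * _"] cong: if_cong)
    qed
    have "(P ** R) $ i $ j = P $ i $ j + u $ i * w $ j" for i j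
    proof -
      have R: "R $ l $ j = mat 1 $ l $ j + (if l = k then w $ j else 0)" for l
        by (auto simp: R_def transpose_def mat_def axis_def)
      have "(P ** R) $ i $ j = (\<Sum>l\<in>UNIV. P $ i $ l * mat 1 $ l $ j) + P $ i $ k * w $ j"
        by (simp add: matrix_matrix_mult_def R ring_distribs sum.distrib
            if_distrib[of "\<lambda>x. _ * x"] cong: if_cong)
      also have "(\<Sum>l\<in>UNIV. P $ i $ l * mat 1 $ l $ j) = P $ i $ j"
        by (simp add: mat_def if_distrib[of "\<lambda>x. _ * x"] cong: if_cong)
      also have "P $ i $ k = u $ i"
        by (simp add: P_def)
      finally show ?thesis .
    qed
    with L show ?thesis
      by (simp add: vec_eq_iff)
  qed
  then have "det (mat 1 + (\<chi> i j. u $ i * v $ j)) * det P = det P * det R"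
    by (metis det_mul)
  moreover have "det P = u $ k"
    unfolding P_def by (rule det_identity_except_column)
  moreover have "det R = 1 + (\<Sum>i\<in>UNIV. v $ i * u $ i)"
    unfolding R_def det_transpose det_identity_except_column by (simp add: w_def axis_def)
  ultimately show ?thesis
    using k by simp
qed

text \<open>The linear map that multiplies \<open>y\<close> by \<open>1 - \<epsilon>\<close> and fixes the orthogonal complement of \<open>y\<close>.\<close>

definition contract :: "complex ^ 'm \<Rightarrow> real \<Rightarrow> complex ^ 'm ^ 'm" where
  "contract y \<epsilon> = mat 1 + (\<chi> i j. (- of_real (\<epsilon> / (norm y)\<^sup>2) * y $ i) * cnj (y $ j))"

lemma det_contract:
  assumes "y \<noteq> 0"
  shows "det (contract y \<epsilon>) = of_real (1 - \<epsilon>)"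
proof -
  have "(\<Sum>i\<in>UNIV. cnj (y $ i) * (- of_real (\<epsilon> / (norm y)\<^sup>2) * y $ i))
      = - of_real (\<epsilon> / (norm y)\<^sup>2) * hdot y y"
    by (simp add: hdot_def sum_distrib_left mult_ac)
  also have "\<dots> = - of_real \<epsilon>"
    using assms by (simp add: hdot_self flip: of_real_mult)
  finally show ?thesis
    using det_identity_plus_rank_one[of "- of_real (\<epsilon> / (norm y)\<^sup>2) *s y" "\<chi> j. cnj (y $ j)"]
    by (simp add: contract_def)
qed

lemma norm_contract:
  assumes "y \<noteq> 0"
  shows "(norm (contract y \<epsilon> *v x))\<^sup>2
    = (norm x)\<^sup>2 - (1 - (1 - \<epsilon>)\<^sup>2) * (norm (hdot x y))\<^sup>2 / (norm y)\<^sup>2"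
proof -
  define c where "c = \<epsilon> / (norm y)\<^sup>2"
  have "contract y \<epsilon> *v x = x - (of_real c * hdot x y) *s y"
    unfolding contract_def c_def[symmetric] matrix_vector_mult_add_rdistrib matrix_vector_mul_lid
    by (simp add: vec_eq_iff matrix_vector_mult_def hdot_def sum_distrib_left sum_distrib_right
        sum_negf mult_ac)
  then have "complex_of_real ((norm (contract y \<epsilon> *v x))\<^sup>2)
      = hdot (x - (of_real c * hdot x y) *s y) (x - (of_real c * hdot x y) *s y)"
    by (simp add: hdot_self)
  also have "\<dots> = hdot x x - 2 * of_real c * (hdot x y * cnj (hdot x y))
      + (of_real c)\<^sup>2 * hdot y y * (hdot x y * cnj (hdot x y))"
    by (simp add: hdot_bilinear cnj_hdot algebra_simps power2_eq_square)
  also have "\<dots> = of_real ((norm x)\<^sup>2 - 2 * c * (norm (hdot x y))\<^sup>2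
      + c\<^sup>2 * (norm y)\<^sup>2 * (norm (hdot x y))\<^sup>2)"
    by (simp add: hdot_self flip: complex_norm_square)
  finally have "(norm (contract y \<epsilon> *v x))\<^sup>2 = (norm x)\<^sup>2 - 2 * c * (norm (hdot x y))\<^sup>2
      + c\<^sup>2 * (norm y)\<^sup>2 * (norm (hdot x y))\<^sup>2"
    by (simp only: of_real_eq_iff)
  also have "\<dots> = (norm x)\<^sup>2 - (1 - (1 - \<epsilon>)\<^sup>2) * (norm (hdot x y))\<^sup>2 / (norm y)\<^sup>2"
    using assms by (simp add: c_def power2_eq_square field_simps)
  finally show ?thesis .
qed

section \<open>Greedy bases\<close>

text \<open>Summation by parts: as \<open>M - f v\<close> is a nonnegative combination of the indicators of
  the sublevel sets of \<open>f\<close>, the weighted sum is the same combination of the sums of \<open>g\<close> over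
  sublevel sets. The induction removes a point where \<open>f\<close> is largest and lowers \<open>M\<close> to the value of
  \<open>f\<close> there; for this reason only levels strictly below \<open>M\<close> may be assumed.\<close>

lemma weighted_sum_nonneg_of_prefix_sums:
  fixes f g :: "'a \<Rightarrow> real"
  assumes "finite S" and "\<And>v. v \<in> S \<Longrightarrow> f v \<le> M"
    and "\<And>\<tau>. \<tau> < M \<Longrightarrow> 0 \<le> (\<Sum>v | v \<in> S \<and> f v \<le> \<tau>. g v)"
  shows "0 \<le> (\<Sum>v\<in>S. g v * (M - f v))"
  using assms
proof (induction S arbitrary: M rule: finite_ranking_induct[where f = f])
  case empty
  then show ?case by simp
next
  case (insert x S)
  show ?case
  proof (cases "x \<in> S")
    case True
    with insert show ?thesis
      by (simp add: insert_absorb)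
  next
    case False
    have pre: "{v. v \<in> insert x S \<and> f v \<le> \<tau>} = {v. v \<in> S \<and> f v \<le> \<tau>}" if "\<tau> < f x" for \<tau>
      using that by auto
    have "0 \<le> (\<Sum>v | v \<in> S \<and> f v \<le> \<tau>. g v)" if "\<tau> < f x" for \<tau>
    proof -
      have "f x \<le> M"
        using insert.prems by simp
      then show ?thesis
        using insert.prems(2)[of \<tau>] that pre[OF that] by simp
    qed
    then have IH: "0 \<le> (\<Sum>v\<in>S. g v * (f x - f v))"
      by (intro insert.IH) (use insert.hyps in auto)
    have "0 \<le> (M - f x) * (\<Sum>v\<in>insert x S. g v)"
    proof (cases "f x < M")
      case True
      moreover have "{v. v \<in> insert x S \<and> f v \<le> f x} = insert x S"
        using insert.hyps by auto
      ultimately show ?thesis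
        using insert.prems(2)[of "f x"] by simp
    next
      case False
      then have "M = f x"
        using insert.prems(1)[of x] by simp
      then show ?thesis
        by simp
    qed
    moreover have "(\<Sum>v\<in>insert x S. g v * (M - f v))
        = (M - f x) * (\<Sum>v\<in>insert x S. g v) + (\<Sum>v\<in>insert x S. g v * (f x - f v))"
      by (simp add: sum_distrib_left flip: sum.distrib) (simp add: algebra_simps)
    moreover have "(\<Sum>v\<in>insert x S. g v * (f x - f v)) = (\<Sum>v\<in>S. g v * (f x - f v))"
      using False insert.hyps by simp
    ultimately show ?thesis
      using IH by linarith
  qed
qed

text \<open>Kruskal's algorithm: running through the vectors in order of increasing \<open>f\<close> and keeping each
  one that is not spanned by those kept before yields a basis that is adapted to all sublevel sets of
  \<open>f\<close> at once.\<close>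

lemma greedy_basis:
  fixes f :: "'a::field ^ 'm \<Rightarrow> real"
  assumes "finite S"
  shows "\<exists>I\<subseteq>S. vec.independent I \<and>
    (\<forall>\<tau>. {v \<in> S. f v \<le> \<tau>} \<subseteq> vec.span {v \<in> I. f v \<le> \<tau>})"
  using assms
proof (induction S rule: finite_ranking_induct[where f = f])
  case empty
  then show ?case by (auto simp: vec.independent_empty)
next
  case (insert x S)
  then obtain I where I: "I \<subseteq> S" "vec.independent I"
    "\<And>\<tau>. {v \<in> S. f v \<le> \<tau>} \<subseteq> vec.span {v \<in> I. f v \<le> \<tau>}"
    by blast
  have lev: "{v \<in> I. f v \<le> \<tau>} = I" if "f x \<le> \<tau>" for \<tau>
    using that I(1) insert.hyps(2) by fastforce
  show ?case
  proof (cases "x \<in> vec.span I")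
    case True
    have "{v \<in> insert x S. f v \<le> \<tau>} \<subseteq> vec.span {v \<in> I. f v \<le> \<tau>}" for \<tau>
      using I(3)[of \<tau>] lev[of \<tau>] True by (cases "f x \<le> \<tau>") auto
    with I show ?thesis
      by (intro exI[of _ I]) auto
  next
    case False
    have "{v \<in> insert x S. f v \<le> \<tau>} \<subseteq> vec.span {v \<in> insert x I. f v \<le> \<tau>}" for \<tau>
    proof -
      have "vec.span {v \<in> I. f v \<le> \<tau>} \<subseteq> vec.span {v \<in> insert x I. f v \<le> \<tau>}"
        by (intro vec.span_mono) auto
      then show ?thesis
        using I(3)[of \<tau>] by (auto intro: vec.span_base)
    qed
    with I False show ?thesis
      by (intro exI[of _ "insert x I"] conjI allI vec.independent_insertI) auto
  qed
qed

section \<open>Radial isotropic position\<close>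

lemma matrix_vector_eq_0_iff:
  fixes T :: "'a::field ^ 'm ^ 'm"
  assumes "det T \<noteq> 0"
  shows "T *v x = 0 \<longleftrightarrow> x = 0"
  using assms by (metis invertible_det_nz invertible_mult invertible_def matrix_vector_mul_assoc
      matrix_vector_mul_lid vec.zero)

lemma norm_det_le_basis:
  fixes I :: "(complex ^ 'm) set"
  assumes "vec.independent I" and "card I = CARD('m)"
  shows "\<exists>c. \<forall>T. norm (det T) \<le> c * (\<Prod>v\<in>I. norm (T *v v))"
proof -
  have "finite I"
    using assms(1) by (rule vec.finiteI_independent)
  then obtain b where b: "bij_betw b (UNIV :: 'm set) I"
    using assms(2) finite_same_card_bij[of "UNIV :: 'm set" I] by auto
  define B :: "complex ^ 'm ^ 'm" where "B = (\<chi> i. b i)"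
  have "c i = 0" if "(\<Sum>i\<in>UNIV. c i *s row i B) = 0" for c i
  proof -
    define d where "d v = c (inv_into UNIV b v)" for v
    have d: "d (b i) = c i" for i
      using b by (simp add: d_def bij_betw_def)
    have "(\<Sum>v\<in>I. d v *s v) = (\<Sum>i\<in>UNIV. d (b i) *s b i)"
      by (rule sum.reindex_bij_betw[OF b, symmetric])
    also have "\<dots> = (\<Sum>i\<in>UNIV. c i *s row i B)"
      by (simp add: d B_def row_def)
    finally have "(\<Sum>v\<in>I. d v *s v) = 0"
      using that by simp
    then have "d (b i) = 0"
      using vec.independentD[OF assms(1) \<open>finite I\<close> subset_refl] b
      by (auto simp: bij_betw_def)
    then show ?thesis
      by (simp add: d)
  qed
  then obtain B' where "B ** B' = mat 1"
    using matrix_right_invertible_independent_rows[of B] by auto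
  then have detB: "det B \<noteq> 0"
    by (metis det_I det_mul mult_zero_left zero_neq_one)
  have "norm (det T) \<le> fact CARD('m) / norm (det B) * (\<Prod>v\<in>I. norm (T *v v))" for T
  proof -
    have "transpose (T ** transpose B) = (\<chi> i. T *v b i)"
      by (simp add: vec_eq_iff B_def transpose_def matrix_matrix_mult_def matrix_vector_mult_def)
    then have "det T * det B = det (\<chi> i. T *v b i)"
      by (metis det_mul det_transpose)
    then have "norm (det T) * norm (det B) = norm (det (\<chi> i. T *v b i))"
      by (metis norm_mult)
    also have "\<dots> \<le> fact CARD('m) * (\<Prod>i\<in>UNIV. norm (T *v b i))"
      using norm_det_le_prod_rows[of "\<chi> i. T *v b i"] by simp
    also have "(\<Prod>i\<in>UNIV. norm (T *v b i)) = (\<Prod>v\<in>I. norm (T *v v))"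
      by (rule prod.reindex_bij_betw[OF b])
    finally show ?thesis
      using detB by (simp add: field_simps)
  qed
  then show ?thesis
    by blast
qed

text \<open>This is the semistability condition of geometric invariant theory for a configuration of points
  in projective space: a subspace of dimension \<open>k\<close> in dimension \<open>d\<close> contains at most the
  proportion \<open>k / d\<close> of the points. It suffices to test subspaces that are spanned by points.\<close>

definition no_crowded_flat :: "(complex ^ 'm) set \<Rightarrow> bool" where
  "no_crowded_flat S \<longleftrightarrow>
    (\<forall>I\<subseteq>S. vec.independent I \<longrightarrow> CARD('m) * card (S \<inter> vec.span I) \<le> card S * card I)"

text \<open>For every basis \<open>I\<close> contained in \<open>S\<close>, the determinant of \<open>T\<close> is at most a constant times the product of the
  lengths of the vectors \<open>T *v v\<close> with \<open>v\<close> in \<open>I\<close>. The greedy basis for the lengths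
  is the best choice. Since no flat is crowded, the vectors of that basis are at every level at least as
  frequent, relative to the size of the basis, as the vectors of \<open>S\<close>; so summation by parts bounds the
  geometric mean of the lengths over the basis by the geometric mean over \<open>S\<close>.\<close>

lemma norm_det_power_bound:
  fixes S :: "(complex ^ 'm) set"
  assumes "finite S" and "0 \<notin> S" and span: "vec.span S = UNIV" and "no_crowded_flat S"
  obtains C where
    "\<And>T. det T \<noteq> 0 \<Longrightarrow> norm (det T) ^ card S \<le> C * (\<Prod>v\<in>S. norm (T *v v)) ^ CARD('m)"
proof -
  define \<B> where "\<B> = {I. I \<subseteq> S \<and> vec.independent I \<and> card I = CARD('m)}"
  have "finite \<B>"
    by (rule finite_subset[of _ "Pow S"]) (use \<open>finite S\<close> in \<open>auto simp: \<B>_def\<close>)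
  have "\<forall>I\<in>\<B>. \<exists>c. \<forall>T. norm (det T) \<le> c * (\<Prod>v\<in>I. norm (T *v v))"
    unfolding \<B>_def by (simp add: norm_det_le_basis)
  then obtain c where c: "\<And>I T. I \<in> \<B> \<Longrightarrow> norm (det T) \<le> c I * (\<Prod>v\<in>I. norm (T *v v))"
    by metis
  define C where "C = (\<Sum>I\<in>\<B>. \<bar>c I\<bar> ^ card S)"
  have "norm (det T) ^ card S \<le> C * (\<Prod>v\<in>S. norm (T *v v)) ^ CARD('m)" if "det T \<noteq> 0" for T
  proof -
    define f where "f v = ln (norm (T *v v))" for v
    have pos: "0 < norm (T *v v)" if "v \<in> S" for v
      using that \<open>det T \<noteq> 0\<close> \<open>0 \<notin> S\<close> by (auto simp: matrix_vector_eq_0_iff)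
    obtain I where I: "I \<subseteq> S" "vec.independent I"
      "\<And>\<tau>. {v \<in> S. f v \<le> \<tau>} \<subseteq> vec.span {v \<in> I. f v \<le> \<tau>}"
      using greedy_basis[OF \<open>finite S\<close>, of f] by blast
    have "finite I"
      using I(1) \<open>finite S\<close> by (rule finite_subset)
    define M where "M = Max (insert 0 (f ` S))"
    have M: "f v \<le> M" if "v \<in> S" for v
      unfolding M_def using that \<open>finite S\<close> by (intro Max_ge) auto
    have "S \<subseteq> vec.span {v \<in> I. f v \<le> M}"
      using I(3)[of M] M by auto
    also have "\<dots> \<subseteq> vec.span I"
      by (intro vec.span_mono) auto
    finally have "vec.span I = UNIV"
      using span vec.span_mono vec.span_span by blast
    then have cardI: "card I = CARD('m)"
      using vec.dim_span_eq_card_independent[OF I(2)] by (simp add: card_cart_basis)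
    then have "I \<in> \<B>"
      using I by (simp add: \<B>_def)
    define g where "g v = real (card S) * (if v \<in> I then 1 else 0) - real CARD('m)" for v
    have sum_g: "(\<Sum>v\<in>A. g v * h v) = real (card S) * (\<Sum>v\<in>A \<inter> I. h v) - real CARD('m) * (\<Sum>v\<in>A. h v)"
      if "A \<subseteq> S" for A h
    proof -
      have "finite A"
        using that \<open>finite S\<close> by (rule finite_subset)
      then show ?thesis
        by (simp add: g_def left_diff_distrib sum_subtractf sum.inter_restrict flip: sum_distrib_left)
          (auto simp: sum_distrib_left intro!: sum.cong)
    qed
    have "0 \<le> (\<Sum>v | v \<in> S \<and> f v \<le> \<tau>. g v)" for \<tau>
    proof -
      have eq: "{v \<in> S. f v \<le> \<tau>} \<inter> I = {v \<in> I. f v \<le> \<tau>}"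
        using I(1) by auto
      have "CARD('m) * card {v \<in> S. f v \<le> \<tau>} \<le> CARD('m) * card (S \<inter> vec.span {v \<in> I. f v \<le> \<tau>})"
        using I(3)[of \<tau>] \<open>finite S\<close> by (intro mult_left_mono card_mono) auto
      also have "\<dots> \<le> card S * card {v \<in> I. f v \<le> \<tau>}"
      proof -
        have "{v \<in> I. f v \<le> \<tau>} \<subseteq> S" "vec.independent {v \<in> I. f v \<le> \<tau>}"
          using I(1) vec.independent_mono[OF I(2), of "{v \<in> I. f v \<le> \<tau>}"] by auto
        then show ?thesis
          using assms(4) unfolding no_crowded_flat_def by blast
      qed
      finally show ?thesis
        using sum_g[of "{v \<in> S. f v \<le> \<tau>}" "\<lambda>_. 1"] by (simp add: eq flip: of_nat_mult)
    qed
    then have "0 \<le> (\<Sum>v\<in>S. g v * (M - f v))"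
      by (intro weighted_sum_nonneg_of_prefix_sums) (use \<open>finite S\<close> M in auto)
    then have "real (card S) * (\<Sum>v\<in>I. f v) \<le> real CARD('m) * (\<Sum>v\<in>S. f v)"
      using I(1) cardI
      by (simp add: sum_g Int_absorb1 sum_subtractf right_diff_distrib)
    then have "exp (real (card S) * (\<Sum>v\<in>I. f v)) \<le> exp (real CARD('m) * (\<Sum>v\<in>S. f v))"
      by simp
    moreover have "exp (f v) = norm (T *v v)" if "v \<in> S" for v
      using pos[OF that] by (simp add: f_def)
    ultimately have le: "(\<Prod>v\<in>I. norm (T *v v)) ^ card S \<le> (\<Prod>v\<in>S. norm (T *v v)) ^ CARD('m)"
      using \<open>finite S\<close> \<open>finite I\<close> I(1)
      by (simp add: exp_of_nat_mult exp_sum subset_eq cong: prod.cong)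
    have "norm (det T) ^ card S \<le> (\<bar>c I\<bar> * (\<Prod>v\<in>I. norm (T *v v))) ^ card S"
    proof (rule power_mono)
      show "norm (det T) \<le> \<bar>c I\<bar> * (\<Prod>v\<in>I. norm (T *v v))"
        by (rule order_trans[OF c[OF \<open>I \<in> \<B>\<close>]]) (intro mult_right_mono prod_nonneg; simp)
    qed simp
    also have "\<dots> = \<bar>c I\<bar> ^ card S * (\<Prod>v\<in>I. norm (T *v v)) ^ card S"
      by (rule power_mult_distrib)
    also have "\<dots> \<le> C * (\<Prod>v\<in>S. norm (T *v v)) ^ CARD('m)"
    proof (rule mult_mono)
      show "\<bar>c I\<bar> ^ card S \<le> C"
        unfolding C_def using \<open>finite \<B>\<close> \<open>I \<in> \<B>\<close> by (intro member_le_sum) auto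
    qed (use le in \<open>auto simp: C_def intro!: sum_nonneg prod_nonneg zero_le_power\<close>)
    finally show ?thesis .
  qed
  then show ?thesis
    by (rule that)
qed

text \<open>The squared cosine of the angle between two complex lines.\<close>

definition coherence :: "complex ^ 'm \<Rightarrow> complex ^ 'm \<Rightarrow> real" where
  "coherence x y = (norm (hdot x y))\<^sup>2 / ((norm x)\<^sup>2 * (norm y)\<^sup>2)"

text \<open>A linear map \<open>T\<close> puts \<open>S\<close> in radial isotropic position if the projections onto the lines
  spanned by the vectors \<open>T *v v\<close> add up to a multiple of the identity (Barthe, Forster); comparing
  traces, the multiple is \<open>n / d\<close>, and the coherences with a fixed vector then sum to \<open>n / d\<close>.
  Maximisers of the scale-invariant quantity \<open>F T\<close> below have this property. An
  approximate maximiser is as good up to the error \<open>\<gamma>\<close>: \<open>F\<close> is bounded because no flat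
  is crowded, and if the coherences with \<open>T *v w\<close> had too large a sum, then contracting along
  \<open>T *v w\<close> would shorten the vectors by more than the determinant pays for and increase \<open>F\<close>
  beyond its supremum.\<close>

theorem approximate_radial_isotropy:
  fixes S :: "(complex ^ 'm) set"
  assumes "finite S" and "0 \<notin> S" and "vec.span S = UNIV" and "no_crowded_flat S"
    and "0 < \<gamma>"
  obtains T where "det T \<noteq> 0"
    and "\<And>w. w \<in> S \<Longrightarrow> (\<Sum>v\<in>S. coherence (T *v v) (T *v w)) \<le> card S / CARD('m) + \<gamma>"
proof -
  define n where "n = card S"
  define d where "d = CARD('m)"
  have "0 < d"
    by (simp add: d_def)
  have "S \<noteq> {}"
  proof
    assume "S = {}"
    with assms(3) have "axis undefined 1 \<in> (vec.span {} :: (complex ^ 'm) set)"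
      by blast
    then show False
      by (simp add: vec.span_empty axis_eq_0_iff)
  qed
  then have "0 < n"
    using \<open>finite S\<close> by (simp add: n_def card_gt_0_iff)
  define F where "F T = norm (det T) ^ n / (\<Prod>v\<in>S. norm (T *v v)) ^ d" for T :: "complex ^ 'm ^ 'm"
  have pos: "0 < norm (T *v v)" if "v \<in> S" "det T \<noteq> 0" for T v
    using that \<open>0 \<notin> S\<close> by (auto simp: matrix_vector_eq_0_iff)
  have prod_pos': "0 < (\<Prod>v\<in>S. norm (T *v v))" if "det T \<noteq> 0" for T
    using pos that by (intro prod_pos) auto
  obtain C where C: "\<And>T. det T \<noteq> 0 \<Longrightarrow> norm (det T) ^ n \<le> C * (\<Prod>v\<in>S. norm (T *v v)) ^ d"
    using norm_det_power_bound[OF assms(1-4)] unfolding n_def d_def by blast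
  define A where "A = F ` {T. det T \<noteq> 0}"
  have "F T \<le> C" if "det T \<noteq> 0" for T
    unfolding F_def using C[OF that] prod_pos'[OF that] by (simp add: divide_le_eq)
  then have bdd: "bdd_above A"
    unfolding A_def by (intro bdd_aboveI2) auto
  have "F (mat 1) \<in> A"
    unfolding A_def by (intro imageI) simp
  have "0 < F (mat 1)"
    unfolding F_def using prod_pos'[of "mat 1"] by simp
  also have "\<dots> \<le> Sup A"
    using \<open>F (mat 1) \<in> A\<close> bdd by (rule cSup_upper)
  finally have "0 < Sup A" .
  \<comment> \<open>The contraction factor is \<open>sqrt (1 - \<delta>)\<close>. In units of \<open>d * \<gamma>\<close>, one half of the
    permitted error pays for the second-order terms in \<open>\<delta>\<close>, by the choice of \<open>\<delta>\<close>, and the other half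
    pays for the distance of \<open>F T\<close> from the supremum, by the choice of \<open>x\<close>.\<close>
  define \<delta> where "\<delta> = 1 - n / (n + d * \<gamma> / 2)"
  have "0 < d * \<gamma>"
    using \<open>0 < d\<close> \<open>0 < \<gamma>\<close> by simp
  then have \<delta>: "0 < \<delta>" "\<delta> < 1" and n\<delta>: "n / (1 - \<delta>) = n + d * \<gamma> / 2"
    unfolding \<delta>_def using \<open>0 < n\<close> by (simp_all add: divide_simps)
  define x where "x = exp (- \<delta> * d * \<gamma> / 4)"
  have "0 < x" "x < 1"
    unfolding x_def using \<delta> \<open>0 < d\<close> \<open>0 < \<gamma>\<close> by (simp_all add: mult_neg_pos)
  then have "x * Sup A < Sup A"
    using \<open>0 < Sup A\<close> by simp
  then obtain T where T: "det T \<noteq> 0" "x * Sup A < F T"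
    using less_cSup_iff[OF _ bdd] \<open>F (mat 1) \<in> A\<close> unfolding A_def by blast
  have "(\<Sum>v\<in>S. coherence (T *v v) (T *v w)) \<le> n / d + \<gamma>" if "w \<in> S" for w
  proof -
    define y where "y = T *v w"
    have "y \<noteq> 0"
      using pos[OF that T(1)] by (simp add: y_def)
    define K where "K = contract y (1 - sqrt (1 - \<delta>))"
    have detK: "det K = of_real (sqrt (1 - \<delta>))"
      unfolding K_def using \<open>y \<noteq> 0\<close> by (simp add: det_contract)
    then have det': "det (K ** T) \<noteq> 0"
      using T(1) \<delta> by (simp add: det_mul)
    define p where "p = (\<Prod>v\<in>S. 1 - \<delta> * coherence (T *v v) y)"
    have norm': "(norm ((K ** T) *v v))\<^sup>2 = (norm (T *v v))\<^sup>2 * (1 - \<delta> * coherence (T *v v) y)"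
      if "v \<in> S" for v
    proof -
      have "(norm ((K ** T) *v v))\<^sup>2
          = (norm (T *v v))\<^sup>2 - \<delta> * (norm (hdot (T *v v) y))\<^sup>2 / (norm y)\<^sup>2"
        using \<delta> norm_contract[OF \<open>y \<noteq> 0\<close>, of "1 - sqrt (1 - \<delta>)" "T *v v"]
        by (simp add: K_def flip: matrix_vector_mul_assoc)
      also have "\<dots> = (norm (T *v v))\<^sup>2 * (1 - \<delta> * coherence (T *v v) y)"
        using pos[OF that T(1)] \<open>y \<noteq> 0\<close> by (simp add: coherence_def field_simps)
      finally show ?thesis .
    qed
    have prod': "(\<Prod>v\<in>S. norm ((K ** T) *v v))\<^sup>2 = (\<Prod>v\<in>S. norm (T *v v))\<^sup>2 * p"
      using norm' by (simp add: p_def prod_power_distrib flip: prod.distrib)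
    have "p > 0"
      using prod' prod_pos'[OF det'] prod_pos'[OF T(1)] by (metis zero_less_mult_pos zero_less_power)
    have "(F (K ** T))\<^sup>2 = (norm (det K))\<^sup>2 ^ n * (norm (det T) ^ n)\<^sup>2
        / ((\<Prod>v\<in>S. norm ((K ** T) *v v))\<^sup>2) ^ d"
      by (simp add: F_def det_mul norm_mult power_divide power_mult_distrib power2_eq_square)
    also have "\<dots> = (F T)\<^sup>2 * (1 - \<delta>) ^ n / p ^ d"
      unfolding prod' using \<delta>
      by (simp add: detK F_def power_divide power_mult_distrib power2_eq_square)
    finally have F': "(F (K ** T))\<^sup>2 = (F T)\<^sup>2 * (1 - \<delta>) ^ n / p ^ d" .
    have "F (K ** T) \<le> Sup A"
      using det' bdd unfolding A_def by (intro cSup_upper) auto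
    then have "x * F (K ** T) \<le> F T"
      using T(2) \<open>0 < x\<close> by (meson mult_left_mono less_imp_le order_trans)
    moreover have "0 \<le> F (K ** T)"
      unfolding F_def by (intro divide_nonneg_nonneg zero_le_power prod_nonneg) auto
    ultimately have "(x * F (K ** T))\<^sup>2 \<le> (F T)\<^sup>2"
      using \<open>0 < x\<close> by (intro power_mono) auto
    then have "(F T)\<^sup>2 * (x\<^sup>2 * (1 - \<delta>) ^ n) \<le> (F T)\<^sup>2 * p ^ d"
      using \<open>p > 0\<close> by (simp add: power_mult_distrib F' divide_simps mult_ac)
    moreover have "0 < F T"
      unfolding F_def using T(1) prod_pos'[OF T(1)] by simp
    ultimately have "x\<^sup>2 * (1 - \<delta>) ^ n \<le> p ^ d"
      by simp
    define \<sigma> where "\<sigma> = (\<Sum>v\<in>S. coherence (T *v v) y)"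
    have "p \<le> exp (- \<delta> * \<sigma>)"
    proof -
      have "p \<le> (\<Prod>v\<in>S. exp (- \<delta> * coherence (T *v v) y))"
        unfolding p_def
      proof (rule prod_mono, intro conjI)
        fix v assume v: "v \<in> S"
        then have "0 < (norm (T *v v))\<^sup>2" "0 \<le> (norm (T *v v))\<^sup>2 * (1 - \<delta> * coherence (T *v v) y)"
          using pos[OF v T(1)] by (simp_all flip: norm')
        then show "0 \<le> 1 - \<delta> * coherence (T *v v) y"
          by (simp add: zero_le_mult_iff)
        show "1 - \<delta> * coherence (T *v v) y \<le> exp (- \<delta> * coherence (T *v v) y)"
          using exp_ge_add_one_self[of "- \<delta> * coherence (T *v v) y"] by simp
      qed
      also have "\<dots> = exp (- \<delta> * \<sigma>)"
        using \<open>finite S\<close> by (simp add: \<sigma>_def exp_sum sum_distrib_left flip: sum_negf)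
      finally show ?thesis .
    qed
    then have "p ^ d \<le> exp (d * (- \<delta> * \<sigma>))"
      unfolding exp_of_nat_mult using \<open>p > 0\<close> by (intro power_mono) auto
    moreover have "exp (n * (- \<delta> / (1 - \<delta>))) \<le> (1 - \<delta>) ^ n"
    proof -
      have "1 / (1 - \<delta>) = 1 + \<delta> / (1 - \<delta>)"
        using \<delta> by (simp add: field_simps)
      also have "\<dots> \<le> exp (\<delta> / (1 - \<delta>))"
        by (rule exp_ge_add_one_self)
      finally have "exp (- \<delta> / (1 - \<delta>)) \<le> 1 - \<delta>"
        using \<delta> by (simp add: exp_minus field_simps)
      then show ?thesis
        unfolding exp_of_nat_mult by (intro power_mono) auto
    qed
    moreover have "x\<^sup>2 = exp (- \<delta> * d * \<gamma> / 2)"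
      by (simp add: x_def power2_eq_square flip: exp_add)
    ultimately have "exp (- \<delta> * d * \<gamma> / 2) * exp (n * (- \<delta> / (1 - \<delta>))) \<le> exp (d * (- \<delta> * \<sigma>))"
      using \<open>x\<^sup>2 * (1 - \<delta>) ^ n \<le> p ^ d\<close>
      by (smt (verit) exp_ge_zero mult_left_mono)
    then have "- \<delta> * d * \<gamma> / 2 + n * (- \<delta> / (1 - \<delta>)) \<le> d * (- \<delta> * \<sigma>)"
      by (simp flip: exp_add)
    then have "\<delta> * (d * \<sigma>) \<le> \<delta> * (d * \<gamma> / 2 + n / (1 - \<delta>))"
      by (simp add: field_simps)
    then have "d * \<sigma> \<le> d * \<gamma> / 2 + n / (1 - \<delta>)"
      using \<delta> by simp
    then have "d * \<sigma> \<le> n + d * \<gamma>"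
      using n\<delta> by linarith
    then show ?thesis
      using \<open>0 < d\<close> by (simp add: \<sigma>_def y_def field_simps)
  qed
  then show ?thesis
    using T(1) that unfolding n_def d_def by blast
qed

section \<open>Two-coloured configurations\<close>

text \<open>Points of projective space are given by one representing vector each. The colours may overlap.\<close>

locale two_coloured =
  fixes Red Blue :: "(complex ^ 'm) set"
  assumes finite_points: "finite (Red \<union> Blue)"
    and nonzero: "0 \<notin> Red \<union> Blue"
    and proportional_eq: "\<And>A B. A \<in> Red \<union> Blue \<Longrightarrow> B \<in> Red \<union> Blue \<Longrightarrow> A \<in> vec.span {B} \<Longrightarrow> A = B"
    and red_on_blue_line: "\<And>A B. A \<in> Blue \<Longrightarrow> B \<in> Blue \<Longrightarrow> A \<noteq> B \<Longrightarrow>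
      \<exists>C\<in>Red. C \<noteq> A \<and> C \<noteq> B \<and> C \<in> vec.span {A, B}"
    and blue_on_red_line: "\<And>A B. A \<in> Red \<Longrightarrow> B \<in> Red \<Longrightarrow> A \<noteq> B \<Longrightarrow>
      \<exists>C\<in>Blue. C \<noteq> A \<and> C \<noteq> B \<and> C \<in> vec.span {A, B}"
begin

abbreviation "points \<equiv> Red \<union> Blue"

lemma swap_colours: "two_coloured Blue Red"
  using finite_points nonzero proportional_eq red_on_blue_line blue_on_red_line
  by unfold_locales (auto simp: Un_commute)

lemma finite_Int_points [simp]: "finite (points \<inter> X)"
  using finite_points by blast

text \<open>Join the red point \<open>Q\<close> to each red point \<open>A\<close> of \<open>W\<close>. The line through \<open>Q\<close> and \<open>A\<close> meets \<open>W\<close> only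
  in \<open>A\<close>, so the blue point on it lies outside \<open>W\<close>, and different \<open>A\<close> give different lines through
  \<open>Q\<close>, hence different blue points.\<close>

lemma card_red_le_card_blue_outside:
  assumes W: "vec.subspace W" and Q: "Q \<in> Red" "Q \<notin> W"
  shows "card (Red \<inter> W) \<le> card (Blue \<inter> (vec.span (insert Q W) - W))"
proof -
  have "\<forall>A\<in>Red \<inter> W. \<exists>C. C \<in> Blue \<and> C \<noteq> A \<and> C \<noteq> Q \<and> C \<in> vec.span {A, Q}"
  proof
    fix A assume "A \<in> Red \<inter> W"
    then have "A \<in> Red" "A \<noteq> Q"
      using Q by auto
    from blue_on_red_line[OF this(1) Q(1) this(2)]
    show "\<exists>C. C \<in> Blue \<and> C \<noteq> A \<and> C \<noteq> Q \<and> C \<in> vec.span {A, Q}"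
      by (simp only: Bex_def)
  qed
  from bchoice[OF this] obtain g where g: "\<And>A. A \<in> Red \<inter> W \<Longrightarrow>
      g A \<in> Blue \<and> g A \<noteq> A \<and> g A \<noteq> Q \<and> g A \<in> vec.span {A, Q}"
    by blast
  have span_W: "vec.span X \<subseteq> W" if "X \<subseteq> W" for X
    using that W by (rule vec.span_minimal)
  show ?thesis
  proof (rule card_inj_on_le[of g])
    show "g ` (Red \<inter> W) \<subseteq> Blue \<inter> (vec.span (insert Q W) - W)"
    proof (intro image_subsetI IntI DiffI)
      fix A assume A: "A \<in> Red \<inter> W"
      show "g A \<in> Blue"
        using g[OF A] by blast
      have "vec.span {A, Q} \<subseteq> vec.span (insert Q W)"
        using A by (intro vec.span_mono) auto
      then show "g A \<in> vec.span (insert Q W)"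
        using g[OF A] by blast
      show "g A \<notin> W"
      proof
        assume "g A \<in> W"
        have "g A \<notin> vec.span {A}"
          using g[OF A] A proportional_eq[of "g A" A] by blast
        moreover have "g A \<in> vec.span (insert Q {A})"
          using g[OF A] by (simp add: insert_commute)
        ultimately have "Q \<in> vec.span (insert (g A) {A})"
          by (rule vec.in_span_insert[rotated])
        then show False
          using span_W[of "insert (g A) {A}"] \<open>g A \<in> W\<close> A Q by blast
      qed
    qed
    show "inj_on g (Red \<inter> W)"
    proof (rule inj_onI, rule ccontr)
      fix A A' assume A: "A \<in> Red \<inter> W" and A': "A' \<in> Red \<inter> W" and eq: "g A = g A'" and "A \<noteq> A'"
      have "g A' \<notin> vec.span {Q}"
        using g[OF A'] Q proportional_eq[of "g A'" Q] by blast
      then have "A' \<in> vec.span (insert (g A) {Q})"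
        unfolding eq using g[OF A'] by (blast intro: vec.in_span_insert)
      also have "\<dots> \<subseteq> vec.span {A, Q}"
        using g[OF A] by (intro vec.span_minimal vec.subspace_span) (auto intro: vec.span_base)
      finally have "A' \<in> vec.span (insert Q {A})"
        by (simp add: insert_commute)
      moreover have "A' \<notin> vec.span {A}"
        using A A' \<open>A \<noteq> A'\<close> proportional_eq[of A' A] by blast
      ultimately have "Q \<in> vec.span (insert A' {A})"
        by (rule vec.in_span_insert)
      then show False
        using span_W[of "insert A' {A}"] A A' Q by blast
    qed
    show "finite (Blue \<inter> (vec.span (insert Q W) - W))"
      using finite_points by simp
  qed
qed

text \<open>Otherwise \<open>W\<close> would contain no red point by the preceding injection, although two
  blue points of \<open>W\<close> force a red one on the line that joins them.\<close>

lemma blue_outside_if_red_outside: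
  assumes W: "vec.subspace W" and x: "x \<in> Red" "x \<notin> W" and two: "2 \<le> card (points \<inter> W)"
  shows "Blue \<inter> (vec.span (insert x W) - W) \<noteq> {}"
proof
  assume empty: "Blue \<inter> (vec.span (insert x W) - W) = {}"
  have "card (Red \<inter> W) \<le> 0"
    using card_red_le_card_blue_outside[OF W x] by (simp add: empty)
  moreover have "finite (Red \<inter> W)"
    using finite_points by simp
  ultimately have no_red: "Red \<inter> W = {}"
    by simp
  obtain A B where "A \<in> points \<inter> W" "B \<in> points \<inter> W" "A \<noteq> B"
    using two card_le_Suc0_iff_eq[of "points \<inter> W"] by fastforce
  then obtain C where "C \<in> Red" "C \<in> vec.span {A, B}"
    using no_red red_on_blue_line[of A B] by blast
  moreover have "vec.span {A, B} \<subseteq> W"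
    using \<open>A \<in> points \<inter> W\<close> \<open>B \<in> points \<inter> W\<close> W by (intro vec.span_minimal) auto
  ultimately show False
    using no_red by blast
qed

text \<open>Under the projection from \<open>W\<close>, the points outside \<open>W\<close> fall into fibres. Each fibre contains both
  colours, so the injections for the two colours bound the red and the blue points of \<open>W\<close>
  separately by the size of the fibre.\<close>

lemma card_points_le_twice_fibre:
  assumes W: "vec.subspace W" and x: "x \<in> points" "x \<notin> W" and two: "2 \<le> card (points \<inter> W)"
  shows "card (points \<inter> W) \<le> 2 * card (points \<inter> (vec.span (insert x W) - W))"
proof -
  interpret swap: two_coloured Blue Red
    by (rule swap_colours)
  define F where "F = points \<inter> (vec.span (insert x W) - W)"
  have "finite F"
    by (simp add: F_def)
  have "x \<in> F"
    using x by (simp add: F_def vec.span_base)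
  have "Red \<inter> F \<noteq> {}" "Blue \<inter> F \<noteq> {}"
    using x \<open>x \<in> F\<close> blue_outside_if_red_outside[OF W _ _ two, of x]
      swap.blue_outside_if_red_outside[OF W, of x] two
    by (auto simp: F_def Un_commute)
  then obtain r b where r: "r \<in> Red" "r \<in> F" and b: "b \<in> Blue" "b \<in> F"
    by blast
  have fibre: "vec.span (insert y W) \<subseteq> vec.span (insert x W)" if "y \<in> F" for y
    using that by (intro vec.span_minimal vec.subspace_span) (auto simp: F_def intro: vec.span_base)
  have "card (Red \<inter> W) \<le> card (Blue \<inter> (vec.span (insert r W) - W))"
    using r by (intro card_red_le_card_blue_outside W) (auto simp: F_def)
  also have "\<dots> \<le> card F"
    using fibre[OF r(2)] \<open>finite F\<close> by (intro card_mono) (auto simp: F_def)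
  finally have "card (Red \<inter> W) \<le> card F" .
  moreover
  have "card (Blue \<inter> W) \<le> card (Red \<inter> (vec.span (insert b W) - W))"
    using b by (intro swap.card_red_le_card_blue_outside W) (auto simp: F_def)
  then have "card (Blue \<inter> W) \<le> card F"
    using fibre[OF b(2)] \<open>finite F\<close>
    by (elim order_trans) (intro card_mono, auto simp: F_def)
  moreover have "card (points \<inter> W) \<le> card (Red \<inter> W) + card (Blue \<inter> W)"
    using card_Un_le[of "Red \<inter> W" "Blue \<inter> W"] by (simp add: Int_Un_distrib2)
  ultimately show ?thesis
    unfolding F_def by linarith
qed

text \<open>Let \<open>W\<close> have dimension \<open>k\<close> and contain \<open>N \<ge> 2\<close> points. Completing a basis of \<open>W\<close> by points of the
  configuration yields \<open>d - k\<close> different fibres over \<open>W\<close>, each of size at least \<open>N / 2\<close>, so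
  \<open>n \<ge> N + (d - k) * N / 2\<close>. As \<open>k \<ge> 2\<close>, this gives \<open>k * n \<ge> d * N\<close>.\<close>

lemma no_crowded_flat_points:
  assumes span: "vec.span points = UNIV"
  shows "no_crowded_flat points"
  unfolding no_crowded_flat_def
proof (intro allI impI)
  fix I assume I: "I \<subseteq> points" "vec.independent I"
  define W where "W = vec.span I"
  define N where "N = card (points \<inter> W)"
  have W: "vec.subspace W"
    by (simp add: W_def)
  have "finite I"
    using I(2) by (rule vec.finiteI_independent)
  have dim: "vec.dim (UNIV :: (complex ^ 'm) set) = CARD('m)"
    by (simp add: card_cart_basis)
  have "CARD('m) \<le> card points"
    using vec.dim_le_card[of "UNIV :: (complex ^ 'm) set" points] span finite_points
    by (simp add: card_cart_basis)
  have "CARD('m) * N \<le> card points * card I"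
  proof (cases "2 \<le> N")
    case False
    have "card I \<ge> 1" if "N \<noteq> 0"
    proof -
      have "I \<noteq> {}"
        using that nonzero by (auto simp: N_def W_def vec.span_empty)
      then show ?thesis
        using \<open>finite I\<close> by (simp add: Suc_le_eq card_gt_0_iff)
    qed
    with False have "N \<le> card I"
      by linarith
    then show ?thesis
      using \<open>CARD('m) \<le> card points\<close> by (simp add: mult_mono)
  next
    case True
    have "2 \<le> card I"
    proof (rule ccontr)
      assume "\<not> 2 \<le> card I"
      then have "card I = 0 \<or> card I = 1"
        by linarith
      then have "I = {} \<or> (\<exists>A. I = {A})"
        using \<open>finite I\<close> by (auto simp: card_1_singleton_iff)
      then have "\<exists>A. points \<inter> W \<subseteq> {A}"
        using I(1) nonzero proportional_eq by (auto simp: W_def vec.span_empty)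
      then have "N \<le> 1"
        unfolding N_def by (metis card_mono card.empty card_insert_disjoint empty_iff finite.emptyI
            finite_insert One_nat_def)
      with True show False
        by simp
    qed
    obtain B where B: "I \<subseteq> B" "B \<subseteq> points" "vec.independent B" "points \<subseteq> vec.span B"
      using vec.maximal_independent_subset_extend[OF I] by blast
    have "finite B"
      using B(3) by (rule vec.finiteI_independent)
    have "vec.span B = UNIV"
      using B(4) span vec.span_mono vec.span_span by blast
    then have cardB: "card B = CARD('m)"
      using vec.dim_span_eq_card_independent[OF B(3)] dim by simp
    have outside: "x \<notin> vec.span (insert y W)" if "x \<in> B - I" "y \<in> B" "x \<noteq> y" for x y
    proof -
      have "W \<subseteq> vec.span (B - {x})"
        unfolding W_def using that B(1) by (intro vec.span_mono) auto
      then have "vec.span (insert y W) \<subseteq> vec.span (B - {x})"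
        using that by (intro vec.span_minimal vec.subspace_span) (auto intro: vec.span_base)
      then show ?thesis
        using B(3) that(1) by (auto simp: vec.dependent_def)
    qed
    have notW: "x \<notin> W" if "x \<in> B - I" for x
    proof -
      have "W \<subseteq> vec.span (B - {x})"
        unfolding W_def using that B(1) by (intro vec.span_mono) auto
      then show ?thesis
        using B(3) that by (auto simp: vec.dependent_def)
    qed
    define F where "F x = points \<inter> (vec.span (insert x W) - W)" for x
    have disjoint: "F x \<inter> F y = {}" if "x \<in> B - I" "y \<in> B - I" "x \<noteq> y" for x y
    proof (rule ccontr)
      assume "F x \<inter> F y \<noteq> {}"
      then obtain z where z: "z \<in> vec.span (insert x W)" "z \<in> vec.span (insert y W)" "z \<notin> W"
        by (auto simp: F_def)
      have "x \<in> vec.span (insert z W)"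
        by (rule vec.in_span_insert[OF z(1)]) (use z(3) W in \<open>simp add: vec.span_eq_iff[THEN iffD2]\<close>)
      also have "\<dots> \<subseteq> vec.span (insert y W)"
        using z(2) by (intro vec.span_minimal vec.subspace_span) (auto intro: vec.span_base)
      finally show False
        using outside that by blast
    qed
    have fin_F: "finite (F x)" for x
      by (simp add: F_def)
    have "card (\<Union>x\<in>B - I. F x) = (\<Sum>x\<in>B - I. card (F x))"
      by (rule card_UN_disjoint) (use \<open>finite B\<close> fin_F disjoint in auto)
    moreover have "card ((points \<inter> W) \<union> (\<Union>x\<in>B - I. F x)) = N + card (\<Union>x\<in>B - I. F x)"
      unfolding N_def using \<open>finite B\<close> fin_F by (intro card_Un_disjoint) (auto simp: F_def)
    ultimately have "N + (\<Sum>x\<in>B - I. card (F x)) = card ((points \<inter> W) \<union> (\<Union>x\<in>B - I. F x))"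
      by simp
    also have "\<dots> \<le> card points"
      using finite_points by (intro card_mono) (auto simp: F_def)
    finally have le: "N + (\<Sum>x\<in>B - I. card (F x)) \<le> card points" .
    have "N \<le> 2 * card (F x)" if "x \<in> B - I" for x
      unfolding F_def N_def
      by (rule card_points_le_twice_fibre) (use W that notW B(2) True in \<open>auto simp: N_def\<close>)
    then have "card (B - I) * N \<le> 2 * (\<Sum>x\<in>B - I. card (F x))"
      using sum_mono[of "B - I" "\<lambda>_. N" "\<lambda>x. 2 * card (F x)"] by (simp add: sum_distrib_left)
    with le have le': "2 * N + card (B - I) * N \<le> 2 * card points"
      by linarith
    have "CARD('m) = card I + card (B - I)"
      using cardB B(1) \<open>finite B\<close> \<open>finite I\<close> card_mono[of B I] by (simp add: card_Diff_subset)
    then have "2 * (CARD('m) * N) = 2 * N * card I + 2 * (card (B - I) * N)"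
      by (simp add: algebra_simps)
    also have "\<dots> \<le> 2 * N * card I + card I * (card (B - I) * N)"
      using \<open>2 \<le> card I\<close> by (intro add_left_mono mult_right_mono) auto
    also have "\<dots> = (2 * N + card (B - I) * N) * card I"
      by (simp add: algebra_simps)
    also have "\<dots> \<le> (2 * card points) * card I"
      using le' by (rule mult_right_mono) simp
    finally show ?thesis
      by simp
  qed
  then show "CARD('m) * card (points \<inter> vec.span I) \<le> card points * card I"
    by (simp add: N_def W_def)
qed

text \<open>For two points of different pure colours \<open>1 + colour v * colour w\<close> is \<open>0\<close>, for two points of
  the same pure colour it is \<open>2\<close>, and it is \<open>1\<close> if one of them has both colours. Half of it is the probability that
  \<open>v\<close> and \<open>w\<close> get the same colour if points with both colours choose one at random.\<close>

definition colour :: "complex ^ 'm \<Rightarrow> real" where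
  "colour v = (if v \<notin> Blue then 1 else if v \<notin> Red then - 1 else 0)"

definition line :: "complex ^ 'm \<Rightarrow> complex ^ 'm \<Rightarrow> (complex ^ 'm) set" where
  "line A B = points \<inter> vec.span {A, B}"

lemma line_eq:
  assumes "A \<in> points" "B \<in> points" "A \<noteq> B" "C \<in> line A B" "D \<in> line A B" "C \<noteq> D"
  shows "line C D = line A B"
proof -
  have CD: "C \<in> points" "D \<in> points" "C \<in> vec.span {A, B}" "D \<in> vec.span {A, B}"
    using assms by (auto simp: line_def)
  have "C \<notin> vec.span {D}"
    using CD assms(6) proportional_eq by blast
  then have "vec.independent {C, D}"
    using CD nonzero by (intro vec.independent_insertI) (auto simp: vec.independent_empty)
  moreover have "vec.dim (vec.span {A, B}) \<le> card {C, D}"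
    using vec.dim_le_card[of "{A, B}" "{A, B}"] assms(3,6) by (simp add: vec.span_superset)
  ultimately have "vec.span {A, B} \<subseteq> vec.span {C, D}"
    by (rule vec.card_ge_dim_independent[rotated]) (use CD in auto)
  moreover have "vec.span {C, D} \<subseteq> vec.span {A, B}"
    using CD by (intro vec.span_minimal) auto
  ultimately show ?thesis
    by (auto simp: line_def)
qed

text \<open>A term is \<open>2\<close> for a point of the opposite pure colour, and at least \<open>1\<close> if \<open>A\<close> or \<open>B\<close> has both colours. If
  \<open>A\<close> is purely red, say, and \<open>X\<close> contains no pure blue point, then the hypothesis yields a point \<open>C\<close> with both
  colours; applied again, to \<open>A\<close> and \<open>C\<close>, it yields a second one. If \<open>A\<close> has both colours, then all terms
  are \<open>1\<close>, and \<open>X\<close> has at least three points because \<open>A\<close> shares a colour with every other one.\<close>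

lemma colour_discrepancy:
  assumes X: "X = points \<inter> vec.span X" and A: "A \<in> X" and two: "2 \<le> card X"
  shows "2 \<le> (\<Sum>B\<in>X - {A}. 1 - colour A * colour B)"
proof -
  define q where "q B = 1 - colour A * colour B" for B
  have "X \<subseteq> points"
    using X by blast
  then have "finite X"
    using finite_points by (rule finite_subset)
  have nonneg: "0 \<le> q B" for B
    by (simp add: q_def colour_def)
  have closed: "C \<in> X" if "C \<in> vec.span {B, B'}" "C \<in> points" "B \<in> X" "B' \<in> X" for B B' C
    using that X vec.span_mono[of "{B, B'}" X] by blast
  have one: ?thesis if "B \<in> X - {A}" "2 \<le> q B" for B
    using that member_le_sum[of B "X - {A}" q] nonneg \<open>finite X\<close> by (auto simp: q_def)
  have two_terms: ?thesis if "B \<in> X - {A}" "C \<in> X - {A}" "B \<noteq> C" "1 \<le> q B" "1 \<le> q C" for B C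
  proof -
    have "q B + q C = sum q {B, C}"
      using that by simp
    also have "\<dots> \<le> sum q (X - {A})"
      using that nonneg \<open>finite X\<close> by (intro sum_mono2) auto
    finally show ?thesis
      using that by (simp add: q_def)
  qed
  have "\<not> X \<subseteq> {A}"
    using two card_mono[of "{A}" X] by auto
  then obtain B where B: "B \<in> X" "B \<noteq> A"
    by blast
  have red: "\<exists>C\<in>Blue. C \<noteq> A \<and> C \<noteq> B \<and> C \<in> X" if "A \<in> Red" "B \<in> Red" "A \<noteq> B" "B \<in> X" for B
    using blue_on_red_line[OF that(1-3)] closed[of _ A B] that A by blast
  have blue: "\<exists>C\<in>Red. C \<noteq> A \<and> C \<noteq> B \<and> C \<in> X" if "A \<in> Blue" "B \<in> Blue" "A \<noteq> B" "B \<in> X" for B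
    using red_on_blue_line[OF that(1-3)] closed[of _ A B] that A by blast
  have points: "C \<in> Red \<or> C \<in> Blue" if "C \<in> X" for C
    using that \<open>X \<subseteq> points\<close> by blast
  consider "A \<in> Red" "A \<in> Blue" | "A \<in> Red" "A \<notin> Blue" | "A \<notin> Red" "A \<in> Blue"
    using points[OF A] by blast
  then show ?thesis
  proof cases
    case 1
    then obtain C where "C \<in> X" "C \<noteq> A" "C \<noteq> B"
      using points[OF B(1)] red[of B] blue[of B] B by metis
    with 1 B show ?thesis
      by (intro two_terms[of B C]) (auto simp: q_def colour_def)
  next
    case 2
    show ?thesis
    proof (cases "\<exists>C\<in>X. C \<notin> Red")
      case True
      then obtain C where "C \<in> X" "C \<notin> Red" by blast
      with 2 points[of C] show ?thesis
        by (intro one[of C]) (auto simp: q_def colour_def)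
    next
      case False
      then have "B \<in> Red"
        using B by blast
      then obtain C where C: "C \<in> Blue" "C \<noteq> A" "C \<noteq> B" "C \<in> X"
        using red[of B] 2 B by metis
      then obtain C' where "C' \<in> Blue" "C' \<noteq> A" "C' \<noteq> C" "C' \<in> X"
        using red[of C] 2 False by metis
      with C 2 False show ?thesis
        by (intro two_terms[of C C']) (auto simp: q_def colour_def)
    qed
  next
    case 3
    show ?thesis
    proof (cases "\<exists>C\<in>X. C \<notin> Blue")
      case True
      then obtain C where "C \<in> X" "C \<notin> Blue" by blast
      with 3 points[of C] show ?thesis
        by (intro one[of C]) (auto simp: q_def colour_def)
    next
      case False
      then have "B \<in> Blue"
        using B by blast
      then obtain C where C: "C \<in> Red" "C \<noteq> A" "C \<noteq> B" "C \<in> X"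
        using blue[of B] 3 B by metis
      then obtain C' where "C' \<in> Red" "C' \<noteq> A" "C' \<noteq> C" "C' \<in> X"
        using blue[of C] 3 False by metis
      with C 3 False show ?thesis
        by (intro two_terms[of C C']) (auto simp: q_def colour_def)
    qed
  qed
qed

end

section \<open>Coherence on a line\<close>

text \<open>For unit vectors \<open>(a x, b x)\<close> in complex 2-space, the double sum is the squared Frobenius norm of
  the sum of the projections onto their spans. That sum is a Hermitian 2 by 2 matrix with trace
  \<open>card X\<close>, so already its diagonal entries \<open>A\<close> and \<open>B\<close> contribute at least half of the squared trace.\<close>

lemma card_sq_half_le_sum_gram:
  fixes a b :: "'a \<Rightarrow> complex"
  assumes unit: "\<And>x. x \<in> X \<Longrightarrow> (norm (a x))\<^sup>2 + (norm (b x))\<^sup>2 = 1"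
  shows "(real (card X))\<^sup>2 / 2 \<le> (\<Sum>x\<in>X. \<Sum>y\<in>X. (norm (a x * cnj (a y) + b x * cnj (b y)))\<^sup>2)"
proof -
  define z where "z x = a x * cnj (b x)" for x
  have expand: "(norm (a x * cnj (a y) + b x * cnj (b y)))\<^sup>2
      = (norm (a x))\<^sup>2 * (norm (a y))\<^sup>2 + (norm (b x))\<^sup>2 * (norm (b y))\<^sup>2 + 2 * Re (z x * cnj (z y))" for x y
  proof -
    have norm_add: "(norm (u + w))\<^sup>2 = (norm u)\<^sup>2 + (norm w)\<^sup>2 + 2 * Re (u * cnj w)" for u w
      unfolding cmod_power2 by (simp add: power2_eq_square algebra_simps)
    have "a x * cnj (a y) * cnj (b x * cnj (b y)) = z x * cnj (z y)"
      by (simp add: z_def)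
    then show ?thesis
      unfolding norm_add by (simp only: norm_mult complex_mod_cnj power_mult_distrib)
  qed
  have cross: "(\<Sum>x\<in>X. \<Sum>y\<in>X. Re (z x * cnj (z y))) = (norm (\<Sum>x\<in>X. z x))\<^sup>2"
  proof -
    have "complex_of_real ((norm (\<Sum>x\<in>X. z x))\<^sup>2) = (\<Sum>x\<in>X. \<Sum>y\<in>X. z x * cnj (z y))"
      by (simp only: complex_norm_square cnj_sum sum_product)
    from arg_cong[OF this, of Re] show ?thesis
      by (simp add: Re_sum)
  qed
  define A B where "A = (\<Sum>x\<in>X. (norm (a x))\<^sup>2)" and "B = (\<Sum>x\<in>X. (norm (b x))\<^sup>2)"
  have "A + B = card X"
    using unit by (simp add: A_def B_def flip: sum.distrib)
  have "(real (card X))\<^sup>2 / 2 \<le> A\<^sup>2 + B\<^sup>2"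
    unfolding \<open>A + B = card X\<close>[symmetric]
    using zero_le_power2[of "A - B"] by (simp add: power2_eq_square algebra_simps)
  also have "\<dots> \<le> A\<^sup>2 + B\<^sup>2 + 2 * (norm (\<Sum>x\<in>X. z x))\<^sup>2"
    by simp
  also have "\<dots> = (\<Sum>x\<in>X. \<Sum>y\<in>X. (norm (a x * cnj (a y) + b x * cnj (b y)))\<^sup>2)"
    unfolding expand cross[symmetric] A_def B_def power2_eq_square[of "sum _ _"] sum_product
    by (simp add: sum.distrib sum_distrib_left)
  finally show ?thesis .
qed

lemma orthogonal_pair_spanning:
  fixes p q :: "complex ^ 'm"
  obtains g where "hdot p g = 0" and "\<And>x. x \<in> vec.span {p, q} \<Longrightarrow> \<exists>\<alpha> \<beta>. x = \<alpha> *s p + \<beta> *s g"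
proof -
  define c where "c = hdot q p / hdot p p"
  define g where "g = q - c *s p"
  have "hdot g p = 0"
    by (cases "p = 0") (simp_all add: g_def c_def hdot_bilinear hdot_self, simp add: hdot_def)
  then have "hdot p g = 0"
    by (metis cnj_hdot complex_cnj_zero)
  moreover have "\<exists>\<alpha> \<beta>. x = \<alpha> *s p + \<beta> *s g" if x: "x \<in> vec.span {p, q}" for x
  proof -
    obtain s where "x - s *s p \<in> vec.span {q}"
      using x vec.span_breakdown_eq[of x p "{q}"] by blast
    then obtain t where "x - s *s p = t *s q"
      unfolding vec.span_singleton by blast
    then have "x = s *s p + t *s q"
      by (simp add: diff_eq_eq add.commute)
    then have "x = (s + t * c) *s p + t *s g"
      by (simp add: g_def vec_eq_iff algebra_simps)
    then show ?thesis
      by blast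
  qed
  ultimately show ?thesis
    by (rule that)
qed

lemma card_sq_half_le_sum_coherence:
  fixes f :: "'a \<Rightarrow> complex ^ 'm"
  assumes "\<And>x. x \<in> X \<Longrightarrow> f x \<noteq> 0" and "\<And>x. x \<in> X \<Longrightarrow> f x \<in> vec.span {p, q}"
  shows "(real (card X))\<^sup>2 / 2 \<le> (\<Sum>x\<in>X. \<Sum>y\<in>X. coherence (f x) (f y))"
proof -
  obtain g where g: "hdot p g = 0" "\<And>x. x \<in> vec.span {p, q} \<Longrightarrow> \<exists>\<alpha> \<beta>. x = \<alpha> *s p + \<beta> *s g"
    using orthogonal_pair_spanning[of p q] by metis
  have g': "hdot g p = 0"
    using g(1) by (metis cnj_hdot complex_cnj_zero)
  have "\<forall>x\<in>X. \<exists>\<alpha> \<beta>. f x = \<alpha> *s p + \<beta> *s g"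
    using g(2) assms(2) by blast
  then obtain \<alpha> \<beta> where f: "\<And>x. x \<in> X \<Longrightarrow> f x = \<alpha> x *s p + \<beta> x *s g"
    by metis
  define a b where "a x = \<alpha> x * norm p / norm (f x)" and "b x = \<beta> x * norm g / norm (f x)" for x
  have inner: "hdot (f x) (f y) = norm (f x) * norm (f y) * (a x * cnj (a y) + b x * cnj (b y))"
    if "x \<in> X" "y \<in> X" for x y
  proof -
    have "hdot (f x) (f y) = \<alpha> x * cnj (\<alpha> y) * (norm p)\<^sup>2 + \<beta> x * cnj (\<beta> y) * (norm g)\<^sup>2"
      using that by (simp add: f hdot_bilinear g g' hdot_self)
    then show ?thesis
      using assms(1) that by (simp add: a_def b_def field_simps power2_eq_square)
  qed
  have "(norm (a x))\<^sup>2 + (norm (b x))\<^sup>2 = 1" if "x \<in> X" for x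
  proof -
    have "complex_of_real ((norm (a x))\<^sup>2 + (norm (b x))\<^sup>2) = a x * cnj (a x) + b x * cnj (b x)"
      by (simp only: complex_norm_square of_real_add)
    also have "\<dots> = 1"
      using inner[OF that that] assms(1)[OF that] by (simp add: hdot_self power2_eq_square)
    finally show ?thesis
      by (simp only: of_real_eq_1_iff)
  qed
  from card_sq_half_le_sum_gram[of X a b, OF this]
  have "(real (card X))\<^sup>2 / 2
      \<le> (\<Sum>x\<in>X. \<Sum>y\<in>X. (norm (a x * cnj (a y) + b x * cnj (b y)))\<^sup>2)" .
  also have "\<dots> = (\<Sum>x\<in>X. \<Sum>y\<in>X. coherence (f x) (f y))"
    using assms(1) by (intro sum.cong refl) (simp add: coherence_def inner norm_mult power_mult_distrib)
  finally show ?thesis .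
qed

lemma coherence_self: "x \<noteq> 0 \<Longrightarrow> coherence x x = 1"
  by (simp add: coherence_def hdot_self power2_eq_square norm_mult)

section \<open>At most three dimensions\<close>

context two_coloured
begin

text \<open>With \<open>t\<close> points on the line, both sides are compared with \<open>t * (t - 2) / 2\<close>: the vectors lie in
  a plane, so all coherences together sum to at least \<open>t\<^sup>2 / 2\<close>, and \<open>t\<close> of this comes from the diagonal; while for
  each \<open>x\<close> the colour sum over the \<open>t - 1\<close> other points is \<open>(t - 1) / 2\<close> minus a quarter of its discrepancy, which is
  at least \<open>2\<close>.\<close>

lemma colours_le_coherence_on_line:
  assumes "A \<in> points" "B \<in> points" "A \<noteq> B" and T: "det T \<noteq> 0"
  defines "X \<equiv> line A B"
  shows "(\<Sum>x\<in>X. \<Sum>y\<in>X - {x}. (1 + colour x * colour y) / 4)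
    \<le> (\<Sum>x\<in>X. \<Sum>y\<in>X - {x}. coherence (T *v x) (T *v y))"
proof -
  define t where "t = real (card X)"
  have "X \<subseteq> points"
    by (simp add: X_def line_def)
  then have "finite X"
    using finite_points by (rule finite_subset)
  have "{A, B} \<subseteq> X"
    using assms by (auto simp: X_def line_def intro: vec.span_base)
  from card_mono[OF \<open>finite X\<close> this] have two: "2 \<le> card X"
    using \<open>A \<noteq> B\<close> by simp
  have "vec.span X = vec.span {A, B}"
  proof
    show "vec.span X \<subseteq> vec.span {A, B}"
      by (intro vec.span_minimal) (auto simp: X_def line_def)
    show "vec.span {A, B} \<subseteq> vec.span X"
      by (rule vec.span_mono[OF \<open>{A, B} \<subseteq> X\<close>])
  qed
  then have "X = points \<inter> vec.span X"
    by (simp add: X_def line_def)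
  have "(\<Sum>y\<in>X - {x}. (1 + colour x * colour y) / 4) \<le> (t - 2) / 2" if "x \<in> X" for x
  proof -
    have "(\<Sum>y\<in>X - {x}. (1 + colour x * colour y) / 4)
        = (\<Sum>y\<in>X - {x}. 1 / 2 - (1 - colour x * colour y) / 4)"
      by (intro sum.cong refl) (simp add: field_simps)
    also have "\<dots> = real (card (X - {x})) / 2 - (\<Sum>y\<in>X - {x}. 1 - colour x * colour y) / 4"
      unfolding sum_subtractf[of "\<lambda>_. 1 / 2"] sum_divide_distrib by simp
    also have "real (card (X - {x})) = t - 1"
      using that \<open>finite X\<close> two by (simp add: t_def of_nat_diff)
    also have "(t - 1) / 2 - (\<Sum>y\<in>X - {x}. 1 - colour x * colour y) / 4 \<le> (t - 2) / 2"
    proof -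
      have "(t - 1) / 2 - s / 4 \<le> (t - 2) / 2" if "2 \<le> s" for s
        using that by (simp add: field_simps)
      then show ?thesis
        using colour_discrepancy[OF \<open>X = points \<inter> vec.span X\<close> that two] by blast
    qed
    finally show ?thesis .
  qed
  then have "(\<Sum>x\<in>X. \<Sum>y\<in>X - {x}. (1 + colour x * colour y) / 4) \<le> t * ((t - 2) / 2)"
    unfolding t_def by (rule sum_bounded_above)
  also have "\<dots> = t\<^sup>2 / 2 - t"
    by (simp add: power2_eq_square field_simps)
  also have "\<dots> \<le> (\<Sum>x\<in>X. \<Sum>y\<in>X. coherence (T *v x) (T *v y)) - t"
  proof -
    have "T *v x \<noteq> 0" if "x \<in> X" for x
      using that \<open>X \<subseteq> points\<close> nonzero T by (auto simp: matrix_vector_eq_0_iff)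
    moreover have "T *v x \<in> vec.span {T *v A, T *v B}" if "x \<in> X" for x
      using that vec.span_image[of T "{A, B}"] by (auto simp: X_def line_def)
    ultimately show ?thesis
      unfolding t_def using card_sq_half_le_sum_coherence[of X "\<lambda>x. T *v x"] by auto
  qed
  also have "\<dots> = (\<Sum>x\<in>X. \<Sum>y\<in>X - {x}. coherence (T *v x) (T *v y))"
  proof -
    have "(\<Sum>y\<in>X. coherence (T *v x) (T *v y)) = 1 + (\<Sum>y\<in>X - {x}. coherence (T *v x) (T *v y))"
      if "x \<in> X" for x
    proof -
      have "T *v x \<noteq> 0"
        using that \<open>X \<subseteq> points\<close> nonzero T by (auto simp: matrix_vector_eq_0_iff)
      then show ?thesis
        using that \<open>finite X\<close> by (simp add: sum.remove coherence_self)
    qed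
    then show ?thesis
      by (simp add: t_def sum.distrib)
  qed
  finally show ?thesis .
qed

lemma sum_pairs_by_lines:
  fixes h :: "complex ^ 'm \<Rightarrow> complex ^ 'm \<Rightarrow> real"
  defines "P \<equiv> SIGMA x:points. points - {x}"
  shows "(\<Sum>x\<in>points. \<Sum>y\<in>points - {x}. h x y)
    = (\<Sum>X\<in>case_prod line ` P. \<Sum>x\<in>X. \<Sum>y\<in>X - {x}. h x y)"
proof -
  have "finite P"
    unfolding P_def using finite_points by blast
  have "(\<Sum>x\<in>points. \<Sum>y\<in>points - {x}. h x y) = (\<Sum>(x, y)\<in>P. h x y)"
    unfolding P_def using finite_points by (intro sum.Sigma) auto
  also have "\<dots> = (\<Sum>X\<in>case_prod line ` P. \<Sum>(x, y)\<in>{p \<in> P. case_prod line p = X}. h x y)"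
    using \<open>finite P\<close> by (rule sum.image_gen)
  also have "\<dots> = (\<Sum>X\<in>case_prod line ` P. \<Sum>x\<in>X. \<Sum>y\<in>X - {x}. h x y)"
  proof (rule sum.cong[OF refl])
    fix X assume "X \<in> case_prod line ` P"
    then obtain A B where AB: "A \<in> points" "B \<in> points" "A \<noteq> B" and X: "X = line A B"
      by (auto simp: P_def)
    have "X \<subseteq> points"
      by (simp add: X line_def)
    then have "finite X"
      using finite_points by (rule finite_subset)
    have "{p \<in> P. case_prod line p = X} = (SIGMA x:X. X - {x})"
    proof (intro set_eqI iffI)
      fix p assume "p \<in> {p \<in> P. case_prod line p = X}"
      then show "p \<in> (SIGMA x:X. X - {x})"
        by (auto simp: P_def line_def intro: vec.span_base)
    next
      fix p assume "p \<in> (SIGMA x:X. X - {x})"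
      then show "p \<in> {p \<in> P. case_prod line p = X}"
        using \<open>X \<subseteq> points\<close> line_eq[OF AB] by (auto simp: P_def X)
    qed
    then show "(\<Sum>(x, y)\<in>{p \<in> P. case_prod line p = X}. h x y) = (\<Sum>x\<in>X. \<Sum>y\<in>X - {x}. h x y)"
      using \<open>finite X\<close> by (simp add: sum.Sigma)
  qed
  finally show ?thesis .
qed

text \<open>For the sum of all coherences, approximate isotropy gives an upper bound close to \<open>n\<^sup>2 / 4\<close> if
  the dimension is at least four. For the lower bound, the pairs are sorted by lines and compared with colours; the
  colour sum over all pairs is easy to bound because \<open>\<Sum>x y. colour x * colour y\<close> is a square. This gives
  \<open>n + n * (n - 2) / 4 = n\<^sup>2 / 4 + n / 2\<close>, and any error below \<open>1 / 2\<close> in the row sums is a contradiction.\<close>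

theorem dimension_less_4:
  assumes span: "vec.span points = UNIV"
  shows "CARD('m) < 4"
proof (rule ccontr)
  assume "\<not> CARD('m) < 4"
  then have four: "4 \<le> real CARD('m)"
    by simp
  define n where "n = real (card points)"
  have "points \<noteq> {}"
  proof
    assume "points = {}"
    then have "axis undefined 1 \<in> (vec.span {} :: (complex ^ 'm) set)"
      using span by simp
    then show False
      by (simp add: vec.span_empty axis_eq_0_iff)
  qed
  then have "0 < n"
    using finite_points by (simp add: n_def card_gt_0_iff)
  obtain T where T: "det T \<noteq> 0"
    and upper: "\<And>y. y \<in> points \<Longrightarrow>
      (\<Sum>x\<in>points. coherence (T *v x) (T *v y)) \<le> n / CARD('m) + 1 / 4"
    unfolding n_def
    by (rule approximate_radial_isotropy[OF finite_points nonzero span no_crowded_flat_points[OF span],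
          of "1 / 4"]) auto
  define P where "P = (SIGMA x:points. points - {x})"
  have "(n - 2) * n / 4 \<le> (\<Sum>x\<in>points. \<Sum>y\<in>points - {x}. (1 + colour x * colour y) / 4)"
  proof -
    have "(\<Sum>y\<in>points - {x}. (1 + colour x * colour y) / 4)
        = (n - 1 + colour x * (\<Sum>y\<in>points. colour y) - (colour x)\<^sup>2) / 4" if "x \<in> points" for x
    proof -
      have "(\<Sum>y\<in>points. (1 + colour x * colour y) / 4) = (n + colour x * (\<Sum>y\<in>points. colour y)) / 4"
        by (simp add: sum.distrib n_def sum_distrib_left flip: sum_divide_distrib)
      then show ?thesis
        using that finite_points by (simp add: sum_diff1 power2_eq_square field_simps)
    qed
    then have "(\<Sum>x\<in>points. \<Sum>y\<in>points - {x}. (1 + colour x * colour y) / 4)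
        = (\<Sum>x\<in>points. (n - 1 + colour x * (\<Sum>y\<in>points. colour y) - (colour x)\<^sup>2) / 4)"
      by (intro sum.cong) auto
    also have "\<dots> = ((n - 1) * n + (\<Sum>x\<in>points. colour x)\<^sup>2 - (\<Sum>x\<in>points. (colour x)\<^sup>2)) / 4"
      by (simp add: sum.distrib sum_subtractf n_def power2_eq_square sum_distrib_right
          flip: sum_divide_distrib)
    also have "\<dots> \<ge> ((n - 1) * n + 0 - n) / 4"
    proof (intro divide_right_mono diff_mono add_left_mono)
      show "(\<Sum>x\<in>points. (colour x)\<^sup>2) \<le> n"
        unfolding n_def using sum_bounded_above[of points "\<lambda>x. (colour x)\<^sup>2" 1]
        by (simp add: colour_def)
    qed simp_all
    also have "((n - 1) * n + 0 - n) / 4 = (n - 2) * n / 4"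
      by (simp add: algebra_simps)
    finally show ?thesis .
  qed
  also have "\<dots> = (\<Sum>X\<in>case_prod line ` P. \<Sum>x\<in>X. \<Sum>y\<in>X - {x}. (1 + colour x * colour y) / 4)"
    unfolding P_def by (rule sum_pairs_by_lines)
  also have "\<dots> \<le> (\<Sum>X\<in>case_prod line ` P. \<Sum>x\<in>X. \<Sum>y\<in>X - {x}. coherence (T *v x) (T *v y))"
  proof (rule sum_mono)
    fix X assume "X \<in> case_prod line ` P"
    then obtain A B where "A \<in> points" "B \<in> points" "A \<noteq> B" "X = line A B"
      by (auto simp: P_def)
    then show "(\<Sum>x\<in>X. \<Sum>y\<in>X - {x}. (1 + colour x * colour y) / 4)
        \<le> (\<Sum>x\<in>X. \<Sum>y\<in>X - {x}. coherence (T *v x) (T *v y))"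
      using colours_le_coherence_on_line T by blast
  qed
  also have "\<dots> = (\<Sum>x\<in>points. \<Sum>y\<in>points - {x}. coherence (T *v x) (T *v y))"
    unfolding P_def by (rule sum_pairs_by_lines[symmetric])
  also have "\<dots> = (\<Sum>x\<in>points. (\<Sum>y\<in>points. coherence (T *v x) (T *v y)) - 1)"
  proof (rule sum.cong[OF refl])
    fix x assume "x \<in> points"
    then have "T *v x \<noteq> 0"
      using nonzero T by (auto simp: matrix_vector_eq_0_iff)
    then show "(\<Sum>y\<in>points - {x}. coherence (T *v x) (T *v y))
        = (\<Sum>y\<in>points. coherence (T *v x) (T *v y)) - 1"
      using \<open>x \<in> points\<close> finite_points by (simp add: sum_diff1 coherence_self)
  qed
  also have "\<dots> = (\<Sum>y\<in>points. \<Sum>x\<in>points. coherence (T *v x) (T *v y)) - n"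
    by (subst sum.swap) (simp add: sum_subtractf n_def)
  also have "\<dots> \<le> n * (n / CARD('m) + 1 / 4) - n"
    unfolding n_def using upper[unfolded n_def] by (intro diff_right_mono sum_bounded_above) auto
  also have "\<dots> \<le> n * (n / 4 + 1 / 4) - n"
    using four \<open>0 < n\<close> by (intro diff_right_mono mult_left_mono add_right_mono divide_left_mono) auto
  finally have "n * (1 / 4) \<le> 0"
    by (simp add: algebra_simps diff_divide_distrib)
  with \<open>0 < n\<close> show False
    by simp
qed

end

section \<open>Projection from points of the configuration\<close>

definition representative :: "(complex ^ 'm) set \<Rightarrow> complex ^ 'm" where
  "representative P = (SOME v. vec.span {v} = P)"

lemma span_representative:
  assumes "\<exists>v. vec.span {v} = P"
  shows "vec.span {representative P} = P"
  unfolding representative_def using assms by (rule someI_ex)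

lemma span_singleton_eqI:
  fixes v w :: "'a::field ^ 'm"
  assumes "v \<in> vec.span {w}" "v \<noteq> 0"
  shows "vec.span {v} = vec.span {w}"
proof -
  obtain k where v: "v = k *s w"
    using assms(1) by (auto simp: vec.span_singleton)
  with assms(2) have "k \<noteq> 0"
    by auto
  with v have "w = inverse k *s v"
    by simp
  then have "w \<in> vec.span {v}"
    unfolding vec.span_singleton by blast
  then have "vec.span {w} \<subseteq> vec.span {v}"
    by (intro vec.span_minimal) auto
  moreover have "vec.span {v} \<subseteq> vec.span {w}"
    using assms(1) by (intro vec.span_minimal) auto
  ultimately show ?thesis
    by blast
qed

text \<open>The hypothesis survives any projection in which the points in the centre are discarded and points
  with the same image are identified, each image keeping all colours of its preimages. Two different images
  come from points \<open>A\<close> and \<open>B\<close> whose joining line is mapped injectively, so the third point \<open>C\<close> on it has an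
  image different from both. Passing to \<open>representative\<close> of the spanned
  line is what identifies points with the same image.\<close>

lemma (in two_coloured) two_coloured_projection:
  fixes M :: "complex ^ 'm ^ 'k"
  defines "\<pi> \<equiv> \<lambda>A. representative (vec.span {M *v A})"
  shows "two_coloured (\<pi> ` {A \<in> Red. M *v A \<noteq> 0}) (\<pi> ` {A \<in> Blue. M *v A \<noteq> 0})"
proof -
  have span_\<pi>: "vec.span {\<pi> A} = vec.span {M *v A}" for A
    unfolding \<pi>_def by (rule span_representative) blast
  then have \<pi>_in: "\<pi> A \<in> vec.span {M *v A}" and M_in: "M *v A \<in> vec.span {\<pi> A}" for A
    using vec.span_base[of "\<pi> A" "{\<pi> A}"] vec.span_base[of "M *v A" "{M *v A}"] by simp_all
  have \<pi>_0: "\<pi> A = 0 \<longleftrightarrow> M *v A = 0" for A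
    using \<pi>_in[of A] M_in[of A] by (auto simp: vec.span_singleton)
  have \<pi>_eqI: "\<pi> A = \<pi> B" if "M *v A \<in> vec.span {M *v B}" "M *v A \<noteq> 0" for A B
    using span_singleton_eqI[OF that] by (simp add: \<pi>_def)
  have third: "M *v C \<noteq> 0 \<and> \<pi> C \<noteq> \<pi> A \<and> \<pi> C \<noteq> \<pi> B \<and> \<pi> C \<in> vec.span {\<pi> A, \<pi> B}"
    if "A \<in> points" "B \<in> points" "C \<in> points" "\<pi> A \<noteq> \<pi> B" "M *v A \<noteq> 0" "M *v B \<noteq> 0"
      "C \<noteq> A" "C \<noteq> B" and C: "C \<in> vec.span {A, B}" for A B C
  proof -
    have not_in: "M *v C \<notin> vec.span {M *v A}"
      if "A \<in> points" "\<pi> A \<noteq> \<pi> B" "M *v B \<noteq> 0" "C \<noteq> A" "C \<in> vec.span {B, A}" for A B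
    proof
      assume "M *v C \<in> vec.span {M *v A}"
      have "C \<notin> vec.span {A}"
        using \<open>C \<in> points\<close> that proportional_eq[of C A] by blast
      then have "B \<in> vec.span (insert C {A})"
        using that(5) by (rule vec.in_span_insert[rotated])
      then have "M *v B \<in> (*v) M ` vec.span {C, A}"
        by blast
      then have "M *v B \<in> vec.span {M *v C, M *v A}"
        using vec.span_image[of M "{C, A}"] by simp
      also have "\<dots> \<subseteq> vec.span {M *v A}"
        using \<open>M *v C \<in> vec.span {M *v A}\<close>
        by (intro vec.span_minimal vec.subspace_span) (auto intro: vec.span_base)
      finally show False
        using \<pi>_eqI[of B A] that by simp
    qed
    have nA: "M *v C \<notin> vec.span {M *v A}"
      using not_in[of A B] that by (simp add: insert_commute)
    have nB: "M *v C \<notin> vec.span {M *v B}"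
      using not_in[of B A] that by simp
    have "M *v C \<in> (*v) M ` vec.span {A, B}"
      using C by blast
    then have "M *v C \<in> vec.span {M *v A, M *v B}"
      using vec.span_image[of M "{A, B}"] by simp
    also have "\<dots> \<subseteq> vec.span {\<pi> A, \<pi> B}"
    proof (rule vec.span_minimal)
      have "vec.span {\<pi> A} \<subseteq> vec.span {\<pi> A, \<pi> B}" "vec.span {\<pi> B} \<subseteq> vec.span {\<pi> A, \<pi> B}"
        by (rule vec.span_mono, simp)+
      then show "{M *v A, M *v B} \<subseteq> vec.span {\<pi> A, \<pi> B}"
        using M_in by blast
    qed simp
    finally have "vec.span {M *v C} \<subseteq> vec.span {\<pi> A, \<pi> B}"
      by (intro vec.span_minimal) auto
    then have "\<pi> C \<in> vec.span {\<pi> A, \<pi> B}"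
      using \<pi>_in by blast
    moreover have "M *v C \<noteq> 0"
      using nA vec.span_zero[of "{M *v A}"] by auto
    moreover have "\<pi> C \<noteq> \<pi> A" "\<pi> C \<noteq> \<pi> B"
      using nA nB M_in[of C] span_\<pi>[of A] span_\<pi>[of B] by auto
    ultimately show ?thesis
      by blast
  qed
  show ?thesis
  proof
    show "finite (\<pi> ` {A \<in> Red. M *v A \<noteq> 0} \<union> \<pi> ` {A \<in> Blue. M *v A \<noteq> 0})"
      using finite_points by simp
    show "0 \<notin> \<pi> ` {A \<in> Red. M *v A \<noteq> 0} \<union> \<pi> ` {A \<in> Blue. M *v A \<noteq> 0}"
    proof
      assume "0 \<in> \<pi> ` {A \<in> Red. M *v A \<noteq> 0} \<union> \<pi> ` {A \<in> Blue. M *v A \<noteq> 0}"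
      then obtain A where "\<pi> A = 0" "M *v A \<noteq> 0"
        by fastforce
      then show False
        using \<pi>_0 by blast
    qed
  next
    fix A' B'
    assume "A' \<in> \<pi> ` {A \<in> Red. M *v A \<noteq> 0} \<union> \<pi> ` {A \<in> Blue. M *v A \<noteq> 0}"
      "B' \<in> \<pi> ` {A \<in> Red. M *v A \<noteq> 0} \<union> \<pi> ` {A \<in> Blue. M *v A \<noteq> 0}"
    then obtain A B where AB: "A' = \<pi> A" "B' = \<pi> B" "M *v A \<noteq> 0"
      by auto
    assume "A' \<in> vec.span {B'}"
    then have "vec.span {\<pi> A} = vec.span {\<pi> B}"
      using AB by (intro span_singleton_eqI) (auto simp: \<pi>_0)
    then show "A' = B'"
      unfolding span_\<pi> AB by (simp add: \<pi>_def)
  next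
    fix A' B'
    assume "A' \<in> \<pi> ` {A \<in> Blue. M *v A \<noteq> 0}" "B' \<in> \<pi> ` {A \<in> Blue. M *v A \<noteq> 0}" "A' \<noteq> B'"
    then obtain A B where AB: "A' = \<pi> A" "B' = \<pi> B" "A \<in> Blue" "B \<in> Blue" "M *v A \<noteq> 0" "M *v B \<noteq> 0"
      by auto
    with \<open>A' \<noteq> B'\<close> obtain C where "C \<in> Red" "C \<noteq> A" "C \<noteq> B" "C \<in> vec.span {A, B}"
      using red_on_blue_line[of A B] by auto
    then show "\<exists>C'\<in>\<pi> ` {A \<in> Red. M *v A \<noteq> 0}. C' \<noteq> A' \<and> C' \<noteq> B' \<and> C' \<in> vec.span {A', B'}"
      using third[of A B C] AB \<open>A' \<noteq> B'\<close> by (intro bexI[of _ "\<pi> C"]) auto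
  next
    fix A' B'
    assume "A' \<in> \<pi> ` {A \<in> Red. M *v A \<noteq> 0}" "B' \<in> \<pi> ` {A \<in> Red. M *v A \<noteq> 0}" "A' \<noteq> B'"
    then obtain A B where AB: "A' = \<pi> A" "B' = \<pi> B" "A \<in> Red" "B \<in> Red" "M *v A \<noteq> 0" "M *v B \<noteq> 0"
      by auto
    with \<open>A' \<noteq> B'\<close> obtain C where "C \<in> Blue" "C \<noteq> A" "C \<noteq> B" "C \<in> vec.span {A, B}"
      using blue_on_red_line[of A B] by auto
    then show "\<exists>C'\<in>\<pi> ` {A \<in> Blue. M *v A \<noteq> 0}. C' \<noteq> A' \<and> C' \<noteq> B' \<and> C' \<in> vec.span {A', B'}"
      using third[of A B C] AB \<open>A' \<noteq> B'\<close> by (intro bexI[of _ "\<pi> C"]) auto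
  qed
qed

text \<open>A basis among the points with at least four elements leads to a contradiction: projecting from
  all but four of them gives a configuration that spans a space of dimension exactly four.\<close>

theorem (in two_coloured) dim_points_le_3: "vec.dim points \<le> 3"
proof (rule ccontr)
  assume "\<not> vec.dim points \<le> 3"
  obtain B where B: "B \<subseteq> points" "vec.independent B" "card B = vec.dim points"
    by (rule vec.basis_exists[of points]) blast
  with \<open>\<not> vec.dim points \<le> 3\<close> have "4 \<le> card B"
    by simp
  then obtain B' where B': "B' \<subseteq> B" "card B' = 4" "finite B'"
    by (rule obtain_subset_with_card_n)
  then obtain \<phi> where \<phi>: "bij_betw \<phi> B' (UNIV :: 4 set)"
    using finite_same_card_bij[of B' "UNIV :: 4 set"] by auto
  define g :: "complex ^ 'm \<Rightarrow> complex ^ 4" where "g b = axis (\<phi> b) 1" for b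
  have "vec.independent B'"
    using B(2) B'(1) by (rule vec.independent_mono)
  then obtain f where f: "Vector_Spaces.linear (*s) (*s) f" "\<And>b. b \<in> B' \<Longrightarrow> f b = g b"
    using vec.linear_independent_extend[of B' g] by blast
  define M where "M = matrix f"
  have M: "M *v b = axis (\<phi> b) 1" if "b \<in> B'" for b
    using f that by (simp add: M_def matrix_works g_def)
  define \<pi> where "\<pi> A = representative (vec.span {M *v A})" for A
  interpret image: two_coloured "\<pi> ` {A \<in> Red. M *v A \<noteq> 0}" "\<pi> ` {A \<in> Blue. M *v A \<noteq> 0}"
    unfolding \<pi>_def by (rule two_coloured_projection)
  have "axis i 1 \<in> vec.span image.points" for i
  proof -
    have "i \<in> \<phi> ` B'"
      using bij_betw_imp_surj_on[OF \<phi>] by simp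
    then obtain b where b: "b \<in> B'" "M *v b = axis i 1"
      using M by blast
    have "vec.span {\<pi> b} = vec.span {M *v b}"
      unfolding \<pi>_def by (rule span_representative) blast
    then have "axis i 1 \<in> vec.span {\<pi> b}"
      using b(2) vec.span_base[of "M *v b" "{M *v b}"] by simp
    moreover have "b \<in> points" "M *v b \<noteq> 0"
      using b B(1) B'(1) by (blast, simp add: axis_eq_0_iff)
    then have "{\<pi> b} \<subseteq> image.points"
      by blast
    then have "vec.span {\<pi> b} \<subseteq> vec.span image.points"
      by (rule vec.span_mono)
    ultimately show ?thesis
      by (rule subsetD[rotated])
  qed
  then have "vec.span (cart_basis :: (complex ^ 4) set) \<subseteq> vec.span image.points"
    by (intro vec.span_minimal) (auto simp: cart_basis_def)
  then have "vec.span image.points = UNIV"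
    by (simp add: span_cart_basis top.extremum_unique)
  from image.dimension_less_4[OF this] show False
    by simp
qed

section \<open>Coplanarity\<close>

theorem theorem2:
  fixes n :: nat and S Red Blue :: "(complex ^ 'd) set set"
  assumes "CARD('d) = n + 1" and "n \<ge> 2"
    and "finite S" and "S \<subseteq> proj_points" and "S = Red \<union> Blue"
    and "\<And>A B. A \<in> Blue \<Longrightarrow> B \<in> Blue \<Longrightarrow> A \<noteq> B \<Longrightarrow>
           \<exists>C\<in>Red. C \<noteq> A \<and> C \<noteq> B \<and> proj_collinear {A, B, C}"
    and "\<And>A B. A \<in> Red \<Longrightarrow> B \<in> Red \<Longrightarrow> A \<noteq> B \<Longrightarrow>
           \<exists>C\<in>Blue. C \<noteq> A \<and> C \<noteq> B \<and> proj_collinear {A, B, C}"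
  shows "proj_coplanar S"
proof -
  have span_rep: "vec.span {representative P} = P" if "P \<in> S" for P
  proof (rule span_representative)
    have P: "vec.subspace P" "vec.dim P = 1"
      using that assms(4) by (auto simp: proj_points_def proj_flat_def)
    obtain B where "B \<subseteq> P" "P \<subseteq> vec.span B" "card B = 1"
      using vec.basis_exists[of P] P(2) by metis
    then obtain v where "v \<in> P" "P \<subseteq> vec.span {v}"
      by (auto simp: card_1_singleton_iff)
    then show "\<exists>v. vec.span {v} = P"
      using P(1) vec.span_minimal[of "{v}" P] by blast
  qed
  have rep_in: "representative P \<in> P" if "P \<in> S" for P
    using span_rep[OF that] vec.span_base[of "representative P" "{representative P}"] by simp
  have rep_nonzero: "representative P \<noteq> 0" if "P \<in> S" for P
  proof
    assume "representative P = 0"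
    then have "vec.dim P = 0"
      using span_rep[OF that] vec.dim_span[of "{0 :: complex ^ 'd}"] by simp
    moreover have "vec.dim P = 1"
      using that assms(4) by (auto simp: proj_points_def proj_flat_def)
    ultimately show False
      by simp
  qed
  have proportional: "P = Q"
    if "P \<in> S" "Q \<in> S" "representative P \<in> vec.span {representative Q}" for P Q
    using span_singleton_eqI[OF that(3) rep_nonzero[OF that(1)]] span_rep that by simp
  have collinear: "representative C \<in> vec.span {representative A, representative B}"
    if ABC: "A \<in> S" "B \<in> S" "C \<in> S" "A \<noteq> B" and coll: "proj_collinear {A, B, C}" for A B C
  proof -
    obtain L where L: "vec.dim L = 2" "A \<subseteq> L" "B \<subseteq> L" "C \<subseteq> L"
      using coll by (auto simp: proj_collinear_def proj_flat_def numeral_2_eq_2)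
    have notin: "representative A \<notin> vec.span {representative B}"
      using proportional ABC by blast
    then have indep: "vec.independent {representative A, representative B}"
      using rep_nonzero ABC by (intro vec.independent_insertI) (auto simp: vec.independent_empty)
    have "representative A \<noteq> representative B"
      using notin vec.span_base[of "representative B" "{representative B}"] by auto
    then have le: "vec.dim L \<le> card {representative A, representative B}"
      using L(1) by simp
    have sub: "{representative A, representative B} \<subseteq> L"
      using L ABC rep_in by blast
    have "L \<subseteq> vec.span {representative A, representative B}"
      by (rule vec.card_ge_dim_independent[OF sub indep le])
    then show ?thesis
      using L rep_in ABC by blast
  qed
  have rep_eqD: "P = Q" if "P \<in> S" "Q \<in> S" "representative P = representative Q" for P Q
    using span_rep[OF that(1)] span_rep[OF that(2)] unfolding that(3) by (rule trans[OF sym])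
  have third: "\<exists>c\<in>representative ` X. c \<noteq> representative A \<and> c \<noteq> representative B \<and>
      c \<in> vec.span {representative A, representative B}"
    if AB: "A \<in> S" "B \<in> S" "A \<noteq> B" and X: "X \<subseteq> S"
      "\<exists>C\<in>X. C \<noteq> A \<and> C \<noteq> B \<and> proj_collinear {A, B, C}" for A B X
  proof -
    obtain C where C: "C \<in> X" "C \<in> S" "C \<noteq> A" "C \<noteq> B" "proj_collinear {A, B, C}"
      using X by blast
    have "representative C \<noteq> representative A" "representative C \<noteq> representative B"
      using C(3,4) rep_eqD[OF C(2) AB(1)] rep_eqD[OF C(2) AB(2)] by blast+
    with collinear[OF AB(1,2) C(2) AB(3) C(5)] show ?thesis
      by (intro bexI[OF _ imageI[OF C(1)]] conjI)
  qed
  have colours: "Red \<subseteq> S" "Blue \<subseteq> S"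
    unfolding assms(5) by blast+
  interpret two_coloured "representative ` Red" "representative ` Blue"
  proof
    show "finite (representative ` Red \<union> representative ` Blue)"
      using assms(3,5) by simp
    show "0 \<notin> representative ` Red \<union> representative ` Blue"
    proof
      assume "0 \<in> representative ` Red \<union> representative ` Blue"
      then have "0 \<in> representative ` S"
        by (simp only: assms(5) image_Un)
      then obtain P where "P \<in> S" "representative P = 0"
        by (auto simp only: image_iff)
      then show False
        using rep_nonzero by blast
    qed
  next
    fix a b
    assume "a \<in> representative ` Red \<union> representative ` Blue"
      "b \<in> representative ` Red \<union> representative ` Blue"
    then obtain P Q where PQ: "P \<in> S" "Q \<in> S" "a = representative P" "b = representative Q"
      using colours by blast
    assume "a \<in> vec.span {b}"
    then show "a = b"
      using proportional[OF PQ(1,2)] PQ(3,4) by simp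
  next
    fix a b
    assume "a \<in> representative ` Blue" "b \<in> representative ` Blue" "a \<noteq> b"
    then obtain A B where AB: "A \<in> Blue" "B \<in> Blue" "A \<noteq> B" "a = representative A" "b = representative B"
      by blast
    show "\<exists>c\<in>representative ` Red. c \<noteq> a \<and> c \<noteq> b \<and> c \<in> vec.span {a, b}"
      unfolding AB(4,5)
      by (rule third[OF subsetD subsetD _ _ assms(6)[OF AB(1-3)], OF colours(2) AB(1) colours(2) AB(2,3) colours(1)])
  next
    fix a b
    assume "a \<in> representative ` Red" "b \<in> representative ` Red" "a \<noteq> b"
    then obtain A B where AB: "A \<in> Red" "B \<in> Red" "A \<noteq> B" "a = representative A" "b = representative B"
      by blast
    show "\<exists>c\<in>representative ` Blue. c \<noteq> a \<and> c \<noteq> b \<and> c \<in> vec.span {a, b}"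
      unfolding AB(4,5)
      by (rule third[OF subsetD subsetD _ _ assms(7)[OF AB(1-3)], OF colours(1) AB(1) colours(1) AB(2,3) colours(2)])
  qed
  obtain B where B: "vec.independent B" "points \<subseteq> vec.span B" "card B = vec.dim points"
    by (rule vec.basis_exists[of points])
  have "card B \<le> 3"
    using B(3) dim_points_le_3 by simp
  obtain B' where B': "B \<subseteq> B'" "vec.independent B'" "UNIV \<subseteq> vec.span B'"
    by (rule vec.maximal_independent_subset_extend[OF subset_UNIV B(1)])
  have "finite B'"
    using B'(2) by (rule vec.finiteI_independent)
  have "vec.span B' = UNIV"
    using B'(3) by blast
  then have "card B' = n + 1"
    using vec.dim_span_eq_card_independent[OF B'(2)] assms(1)
    by (simp only: vec.dim_UNIV card_cart_basis)
  then obtain B'' where B'': "B \<subseteq> B''" "B'' \<subseteq> B'" "card B'' = 3"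
    using exists_subset_between[of B 3 B'] \<open>card B \<le> 3\<close> B'(1) \<open>finite B'\<close> assms(2) by auto
  have "proj_flat 2 (vec.span B'')"
    using vec.independent_mono[OF B'(2) B''(2)] B''(3)
    by (simp add: proj_flat_def vec.dim_eq_card_independent)
  moreover have "P \<subseteq> vec.span B''" if "P \<in> S" for P
  proof -
    have "representative P \<in> vec.span B"
      using that assms(5) B(2) by blast
    then have "representative P \<in> vec.span B''"
      using vec.span_mono[OF B''(1)] by blast
    then have "vec.span {representative P} \<subseteq> vec.span B''"
      by (intro vec.span_minimal) auto
    then show ?thesis
      using span_rep[OF that] by simp
  qed
  ultimately show ?thesis
    unfolding proj_coplanar_def by blast
qed

end
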